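(* Let $F$ be the isoperimetric quotient of three-dimensional lattices as a function of the six Selling parameters $(a,b,c,d,e,f)$, and let $\boldsymbol{\rho}_{\mathrm{FCC}}=(0,1,1,1,1,0)$. Then: 1. $\boldsymbol{\rho}_{\mathrm{FCC}}$ is a stationary point of $F$ in $\mathbb{R}_{\ge 0}^6$, but it is not a local minimiser of $F$; more precisely, $\boldsymbol{\rho}_{\mathrm{FCC}}$ is a saddle point of $F$. 2. On the boundary stratum $\Sigma_{\mathrm{RD}}=\{\boldsymbol{\rho}=(a,b,c,d,e,f)\in\mathbb{R}_{\ge 0}^6:\ a=f=0\}$, $\boldsymbol{\rho}_{\mathrm{FCC}}$ is a strict local minimiser of $F$ at fixed volume, i.e. it is a strict local minimiser of the restriction of $F$ to $\{\boldsymbol{\rho}\in\Sigma_{\mathrm{RD}}:\ \det A(\boldsymbol{\rho})=\det A(\boldsymbol{\rho}_{\mathrm{FCC}})\}$.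
   Context: For $\boldsymbol{\rho}=(\rho_{01},\rho_{02},\rho_{03},\rho_{12},\rho_{13},\rho_{23})=(a,b,c,d,e,f)\in\mathbb{R}_{\ge 0}^6$ (Selling parameters) put $$A(\boldsymbol{\rho})=\begin{pmatrix} a+d+e & -d & -e\\ -d & b+d+f & -f\\ -e & -f & c+e+f\end{pmatrix}.$$ When $\det A(\boldsymbol{\rho})>0$, $A(\boldsymbol{\rho})$ is the Gram matrix of a basis $(b_1,b_2,b_3)$ of a lattice $\Lambda\subset\mathbb{R}^3$ with $\rho_{ij}=-\langle b_i,b_j\rangle$ for $0\le i<j\le 3$, where $b_0=-b_1-b_2-b_3$. The function $F$ is defined for $\boldsymbol{\rho}\in\mathbb{R}_{\ge0}^6$ with $\det A(\boldsymbol{\rho})>0$ by $F(\boldsymbol{\rho})=A_T(\boldsymbol{\rho})/(\det A(\boldsymbol{\rho}))^{1/3}$, where $A_T(\boldsymbol{\rho})$ is the surface area of the Voronoi cell of $\Lambda$ (whose volume is $\sqrt{\det A(\boldsymbol{\rho})}$). Explicitly, $$ \begin{aligned} F(a,b,c,d,e,f)=\frac{2}{(\det A)^{5/6}}\Big(& a f \sqrt{b+c+d+e} + b e \sqrt{a+c+d+f} + c d \sqrt{a+b+e+f} \\ &+ \sqrt{a+b+c}\,(de+df+ef) + \sqrt{a+d+e}\,(bc+bf+cf) \\ &+ \sqrt{b+d+f}\,(ac+ae+ce) + \sqrt{c+e+f}\,(ab+ad+bd)\Big). \end{aligned} $$ A point of $\mathbb{R}_{\ge 0}^6$ is stationary for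 $F$ if all six partial derivatives of $F$ vanish there (one-sided derivatives in the coordinates equal to $0$; equivalently, derivatives of the explicit formula, which is smooth in a neighbourhood of $\boldsymbol{\rho}_{\mathrm{FCC}}$ in $\mathbb{R}^6$). Local minimality in part 1 refers to $F$ on $\mathbb{R}_{\ge 0}^6$; a saddle point is a stationary point that is neither a local minimiser nor a local maximiser. The point $\boldsymbol{\rho}_{\mathrm{FCC}}$ corresponds to the face-centered cubic lattice, and the stratum $\Sigma_{\mathrm{RD}}$ corresponds to (combinatorial) rhombic dodecahedra. *)

theory Defs
  imports "HOL-Analysis.Analysis"
begin

section \<open>Lattices, Voronoi cells and surface area\<close>

definition lattice_of :: "real^3^3 \<Rightarrow> (real^3) set" where
  "lattice_of B = {\<Sum>i\<in>UNIV. of_int (m i) *\<^sub>R (B $ i) |m :: 3 \<Rightarrow> int. True}"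

definition voronoi_cell :: "'a::euclidean_space set \<Rightarrow> 'a set" where
  "voronoi_cell L = {x. \<forall>l\<in>L. dist x 0 \<le> dist x l}"

text \<open>
  The (codimension one) area of a flat set \<open>S\<close> is the volume of a right prism of height 1
  with base \<open>S\<close>. If \<open>S\<close> spans a hyperplane then the unit normal \<open>n\<close> is unique up to sign,
  and the sign does not affect the volume.
\<close>

definition unit_normal :: "'a::euclidean_space set \<Rightarrow> 'a" where
  "unit_normal S = (SOME n. norm n = 1 \<and> (\<forall>x\<in>S. \<forall>y\<in>S. n \<bullet> (x - y) = 0))"

definition facet_area :: "'a::euclidean_space set \<Rightarrow> real" where
  "facet_area S = measure lebesgue {x + t *\<^sub>R unit_normal S |x t. x \<in> S \<and> t \<in> {0..1}}"

definition surface_area :: "'a::euclidean_space set \<Rightarrow> real" where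
  "surface_area P = (\<Sum>S | S facet_of P. facet_area S)"


section \<open>Selling parameters and the isoperimetric quotient\<close>

text \<open>The parameters are \<open>(a, b, c, d, e, f)\<close> = \<open>(\<rho>01, \<rho>02, \<rho>03, \<rho>12, \<rho>13, \<rho>23)\<close>.\<close>

type_synonym selling = "real \<times> real \<times> real \<times> real \<times> real \<times> real"

definition selling_orthant :: "selling set" where
  "selling_orthant =
    {(a, b, c, d, e, f). a \<ge> 0 \<and> b \<ge> 0 \<and> c \<ge> 0 \<and> d \<ge> 0 \<and> e \<ge> 0 \<and> f \<ge> 0}"

fun selling_matrix :: "selling \<Rightarrow> real^3^3" where
  "selling_matrix (a, b, c, d, e, f) =
    vector [vector [a + d + e, - d, - e],
            vector [- d, b + d + f, - f],
            vector [- e, - f, c + e + f]]"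

definition selling_domain :: "selling set" where
  "selling_domain = {\<rho> \<in> selling_orthant. det (selling_matrix \<rho>) > 0}"

text \<open>
  The rows of \<open>B\<close> are \<open>b\<^sub>1, b\<^sub>2, b\<^sub>3\<close>. With \<open>b\<^sub>0 = - b\<^sub>1 - b\<^sub>2 - b\<^sub>3\<close>, having Gram matrix
  \<open>selling_matrix \<rho>\<close> says exactly that \<open>\<rho>ij = - (b\<^sub>i \<bullet> b\<^sub>j)\<close> for \<open>0 \<le> i < j \<le> 3\<close>.
\<close>

definition has_selling_parameters :: "real^3^3 \<Rightarrow> selling \<Rightarrow> bool" where
  "has_selling_parameters B \<rho> \<longleftrightarrow> (\<forall>i j. B $ i \<bullet> B $ j = selling_matrix \<rho> $ i $ j)"

text \<open>
  For \<open>\<rho> \<in> selling_domain\<close> such a basis exists, and any two of them differ by an orthogonal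
  transformation, so the surface area of the Voronoi cell does not depend on the choice.
  Outside \<open>selling_domain\<close> the value is irrelevant.
\<close>

definition selling_lattice :: "selling \<Rightarrow> (real^3) set" where
  "selling_lattice \<rho> = lattice_of (SOME B. has_selling_parameters B \<rho>)"

definition iso_quotient :: "selling \<Rightarrow> real" where
  "iso_quotient \<rho> =
    surface_area (voronoi_cell (selling_lattice \<rho>)) / det (selling_matrix \<rho>) powr (1/3)"

definition rho_FCC :: selling where
  "rho_FCC = (0, 1, 1, 1, 1, 0)"

definition Sigma_RD :: "selling set" where
  "Sigma_RD = {(a, b, c, d, e, f) \<in> selling_orthant. a = 0 \<and> f = 0}"


section \<open>Stationary points and local extrema relative to a domain\<close>

text \<open>
  The partial derivatives are taken within \<open>D\<close>, hence they are one-sided in the coordinates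
  in which \<open>x\<close> lies on the boundary of the orthant.
\<close>

definition stationary_point :: "('a::euclidean_space \<Rightarrow> real) \<Rightarrow> 'a set \<Rightarrow> 'a \<Rightarrow> bool" where
  "stationary_point f D x \<longleftrightarrow> x \<in> D \<and>
    (\<forall>u\<in>Basis. ((\<lambda>t. f (x + t *\<^sub>R u)) has_real_derivative 0)
                  (at 0 within {t. x + t *\<^sub>R u \<in> D}))"

definition local_minimiser :: "('a::topological_space \<Rightarrow> real) \<Rightarrow> 'a set \<Rightarrow> 'a \<Rightarrow> bool" where
  "local_minimiser f D x \<longleftrightarrow> x \<in> D \<and> (\<forall>\<^sub>F y in at x within D. f x \<le> f y)"

definition local_maximiser :: "('a::topological_space \<Rightarrow> real) \<Rightarrow> 'a set \<Rightarrow> 'a \<Rightarrow> bool" where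
  "local_maximiser f D x \<longleftrightarrow> x \<in> D \<and> (\<forall>\<^sub>F y in at x within D. f y \<le> f x)"

definition strict_local_minimiser :: "('a::topological_space \<Rightarrow> real) \<Rightarrow> 'a set \<Rightarrow> 'a \<Rightarrow> bool" where
  "strict_local_minimiser f D x \<longleftrightarrow> x \<in> D \<and> (\<forall>\<^sub>F y in at x within D. f x < f y)"

definition saddle_point :: "('a::euclidean_space \<Rightarrow> real) \<Rightarrow> 'a set \<Rightarrow> 'a \<Rightarrow> bool" where
  "saddle_point f D x \<longleftrightarrow>
    stationary_point f D x \<and> \<not> local_minimiser f D x \<and> \<not> local_maximiser f D x"

end

theory Submission
  imports Defs "HOL-Real_Asymp.Real_Asymp"
begin

text \<open>
  For an obtuse superbase the Voronoi cell is cut out by the fourteen vectors \<open>\<plusminus> b\<^sub>S\<close>, where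
  \<open>b\<^sub>S\<close> is the sum of the \<open>b\<^sub>i\<close> with \<open>i \<in> S\<close>: an integer combination of the \<open>b\<^sub>i\<close> splits into
  its level sets, and \<open>|m| \<le> m\<^sup>2\<close> for integers. In the coordinates \<open>b\<^sub>i \<bullet> x\<close> every facet is, after
  a translation, a hexagon or a rectangle with explicit side conditions; hence the formula for the
  surface area, in which degenerate facets contribute \<open>0\<close>.

  With this formula, the area form at the FCC point is stationary relative to the determinant. Along
  \<open>(t, 1, 1, 1, 1, t)\<close>, towards the BCC lattice, the quotient decreases to second order; along
  \<open>(t, 1, 1, 1, 1, 0)\<close> it increases. On the stratum \<open>a = f = 0\<close> the inverses of
  \<open>b, c, d, e\<close> turn both the area form and the determinant into symmetric functions of four
  variables, and a second order estimate of the square roots together with Bernoulli's inequality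
  gives the strict minimum.
\<close>

section \<open>Surface area of a cell given by perpendicular bisectors\<close>

definition tight_face :: "'a::euclidean_space set \<Rightarrow> 'a \<Rightarrow> 'a set" where
  "tight_face P v = P \<inter> {x. v \<bullet> x = v \<bullet> v / 2}"

text \<open>The set measured by \<open>facet_area\<close>, with the normal as a parameter, so that
  it can be given explicitly instead of through the choice in \<open>unit_normal\<close>.\<close>

definition prism :: "'a::euclidean_space \<Rightarrow> 'a set \<Rightarrow> 'a set" where
  "prism n S = {x + t *\<^sub>R n |x t. x \<in> S \<and> t \<in> {0..1}}"

text \<open>Substitute \<open>1 - t\<close> for the height \<open>t\<close>. A unit normal is
  determined only up to sign, so the area must not see this change.\<close>

lemma prism_uminus_normal: "prism (- n) S = (+) (- n) ` prism n S"
proof -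
  have "\<exists>y s. x + t *\<^sub>R (- n) = - n + (y + s *\<^sub>R n) \<and> y \<in> S \<and> 0 \<le> s \<and> s \<le> 1"
    if "x \<in> S" "0 \<le> t" "t \<le> 1" for x t
    using that by (intro exI[of _ x] exI[of _ "1 - t"]) (auto simp: algebra_simps)
  moreover have "\<exists>y s. - n + (x + t *\<^sub>R n) = y + s *\<^sub>R (- n) \<and> y \<in> S \<and> 0 \<le> s \<and> s \<le> 1"
    if "x \<in> S" "0 \<le> t" "t \<le> 1" for x t
    using that by (intro exI[of _ x] exI[of _ "1 - t"]) (auto simp: algebra_simps)
  ultimately show ?thesis
    unfolding prism_def by (fastforce simp: image_iff)
qed

lemma measure_prism_uminus:
  "measure lebesgue (prism (- n) S) = measure lebesgue (prism n S)"
  by (simp only: prism_uminus_normal measure_translation)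

text \<open>The extra point \<open>x0 + n\<close> raises the affine dimension by at most one, so
  base and normal direction still fit into a hyperplane. Degenerate faces thus contribute zero and
  can stay in the sum.\<close>

lemma measure_prism_lowdim:
  fixes F :: "'a::euclidean_space set"
  assumes "aff_dim F < int DIM('a) - 1"
  shows "measure lebesgue (prism n F) = 0"
proof (cases "F = {}")
  case True
  then show ?thesis by (simp add: prism_def)
next
  case False
  then obtain x0 where x0: "x0 \<in> F" by auto
  let ?G = "insert (x0 + n) F"
  have "aff_dim ?G < DIM('a)"
    using assms by (auto simp: aff_dim_insert)
  then obtain w c where w: "w \<noteq> 0" "?G \<subseteq> {x. w \<bullet> x = c}"
    by (rule aff_lowdim_subset_hyperplane)
  then have "w \<bullet> n = 0"
    using x0 by (auto simp: inner_add_right)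
  then have "prism n F \<subseteq> {x. w \<bullet> x = c}"
    using w by (auto simp: prism_def inner_add_right)
  then have "negligible (prism n F)"
    using negligible_hyperplane[of w c] w negligible_subset by blast
  then show ?thesis
    by (rule negligible_imp_measure0)
qed

lemma aff_dim_subset_hyperplane_le:
  fixes F :: "'a::euclidean_space set"
  assumes "F \<subseteq> {x. v \<bullet> x = c}" "v \<noteq> 0"
  shows "aff_dim F \<le> int DIM('a) - 1"
  using aff_dim_subset[OF assms(1)] assms(2) by (simp add: of_nat_diff DIM_positive Suc_leI)

lemma affine_hull_subset_hyperplane:
  fixes F :: "'a::euclidean_space set"
  assumes "F \<subseteq> {x. v \<bullet> x = c}" "v \<noteq> 0" "aff_dim F = int DIM('a) - 1"
  shows "affine hull F = {x. v \<bullet> x = c}"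
proof (rule affine_dim_equal)
  show "affine hull F \<noteq> {}"
    using assms by (auto simp: aff_dim_empty_eq)
  show "affine hull F \<subseteq> {x. v \<bullet> x = c}"
    using assms by (simp add: hull_minimal affine_hyperplane)
qed (use assms in \<open>auto simp: affine_hyperplane aff_dim_hyperplane\<close>)

text \<open>The affine hull of \<open>F\<close> is a hyperplane orthogonal to both \<open>v\<close>
  and the chosen normal \<open>n'\<close>. Removing from \<open>n'\<close> its component along
  \<open>n\<close> leaves a vector parallel to this hyperplane, hence orthogonal to
  \<open>n'\<close> as well. This gives \<open>k * k = 1\<close>, and the remainder has squared norm
  \<open>1 - k * k = 0\<close>.\<close>

lemma unit_normal_hyperplane:
  fixes F :: "'a::euclidean_space set"
  assumes F: "F \<subseteq> {x. v \<bullet> x = c}" and v: "v \<noteq> 0" and dim: "aff_dim F = int DIM('a) - 1"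
  shows "unit_normal F = v /\<^sub>R norm v \<or> unit_normal F = - (v /\<^sub>R norm v)"
proof -
  define n where "n = v /\<^sub>R norm v"
  define n' where "n' = unit_normal F"
  have nn: "norm n = 1" and vn: "v = norm v *\<^sub>R n"
    using v by (simp_all add: n_def)
  have "n \<bullet> (x - y) = 0" if "x \<in> F" "y \<in> F" for x y
  proof -
    have "v \<bullet> (x - y) = 0"
      using F that by (auto simp: inner_diff_right)
    then show ?thesis
      by (simp add: n_def)
  qed
  then have "\<exists>n. norm n = 1 \<and> (\<forall>x\<in>F. \<forall>y\<in>F. n \<bullet> (x - y) = 0)"
    using nn by blast
  then have n': "norm n' = 1 \<and> (\<forall>x\<in>F. \<forall>y\<in>F. n' \<bullet> (x - y) = 0)"
    unfolding n'_def unit_normal_def by (rule someI_ex)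
  then have norm0: "n' \<noteq> 0"
    by auto
  have "F \<noteq> {}"
    using dim by (auto simp: aff_dim_empty_eq)
  then obtain x0 where x0: "x0 \<in> F" by auto
  have "n' \<bullet> x = n' \<bullet> x0" if "x \<in> F" for x
    using n' that x0 by (metis inner_diff_right right_minus_eq)
  then have "F \<subseteq> {x. n' \<bullet> x = n' \<bullet> x0}"
    by blast
  then have "affine hull F = {x. n' \<bullet> x = n' \<bullet> x0}"
    using norm0 dim by (rule affine_hull_subset_hyperplane)
  then have eq: "{x. v \<bullet> x = c} = {x. n' \<bullet> x = n' \<bullet> x0}"
    using affine_hull_subset_hyperplane[OF F v dim] by simp
  have nn1: "n \<bullet> n = 1" "n' \<bullet> n' = 1"
    using nn n' by (simp_all add: norm_eq_1)
  define k where "k = n' \<bullet> n"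
  have "n \<bullet> (n' - k *\<^sub>R n) = 0"
    by (simp add: inner_diff_right nn1 k_def inner_commute)
  then have "v \<bullet> (n' - k *\<^sub>R n) = 0"
    by (subst vn) simp
  moreover have "v \<bullet> x0 = c"
    using F x0 by auto
  ultimately have "v \<bullet> (x0 + (n' - k *\<^sub>R n)) = c"
    by (simp only: inner_add_right)
  then have "n' \<bullet> (x0 + (n' - k *\<^sub>R n)) = n' \<bullet> x0"
    using eq by blast
  then have k: "k * k = 1"
    by (simp add: inner_add_right inner_diff_right nn1 k_def)
  have "(n' - k *\<^sub>R n) \<bullet> (n' - k *\<^sub>R n) = 1 - 2 * (k * k) + k * k"
    by (simp add: inner_diff_right inner_diff_left nn1 k_def inner_commute)
  then have "n' = k *\<^sub>R n"
    using k by simp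
  moreover have "k = 1 \<or> k = - 1"
    using k by (simp add: square_eq_1_iff)
  ultimately show ?thesis
    unfolding n'_def n_def by auto
qed

lemma facet_area_hyperplane:
  fixes F :: "'a::euclidean_space set"
  assumes "F \<subseteq> {x. v \<bullet> x = c}" "v \<noteq> 0" "aff_dim F = int DIM('a) - 1"
  shows "facet_area F = measure lebesgue (prism (v /\<^sub>R norm v) F)"
proof -
  have "facet_area F = measure lebesgue (prism (unit_normal F) F)"
    by (simp add: facet_area_def prism_def)
  with unit_normal_hyperplane[OF assms] show ?thesis
    by (metis measure_prism_uminus)
qed

text \<open>The facets are exactly the tight faces of codimension one, and different vectors have
  different bisectors, so the sum over facets can be reindexed by \<open>N\<close>; tight faces of
  lower dimension add zero.\<close>

lemma surface_area_tight_faces: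
  fixes N :: "'a::euclidean_space set"
  assumes N: "finite N" "0 \<notin> N" and P: "P = {x. \<forall>v\<in>N. v \<bullet> x \<le> v \<bullet> v / 2}"
  shows "surface_area P = (\<Sum>v\<in>N. measure lebesgue (prism (v /\<^sub>R norm v) (tight_face P v)))"
proof -
  let ?F = "tight_face P"
  let ?N = "{v \<in> N. aff_dim (?F v) = int DIM('a) - 1}"
  have pos: "v \<bullet> v > 0" if "v \<in> N" for v
    using that N by auto
  have PI: "P = (\<Inter>v\<in>N. {x. v \<bullet> x \<le> v \<bullet> v / 2})"
    by (auto simp: P)
  have "convex P"
    unfolding PI by (intro convex_INT convex_halfspace_le)
  have interior: "x \<in> interior P" if "\<And>v. v \<in> N \<Longrightarrow> v \<bullet> x < v \<bullet> v / 2" for x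
  proof (rule interiorI)
    show "open (\<Inter>v\<in>N. {x. v \<bullet> x < v \<bullet> v / 2})"
      using N by (intro open_INT ballI open_halfspace_lt)
  qed (use that in \<open>auto simp: P intro: less_imp_le\<close>)
  have "0 \<in> interior P"
    using pos by (intro interior) auto
  then have dimP: "aff_dim P = DIM('a)"
    using aff_dim_nonempty_interior by auto
  have face: "?F v face_of P" if "v \<in> N" for v
    unfolding tight_face_def using that \<open>convex P\<close>
    by (intro face_of_Int_supporting_hyperplane_le) (auto simp: P)
  have sub: "?F v \<subseteq> {x. v \<bullet> x = v \<bullet> v / 2}" for v
    by (auto simp: tight_face_def)
  have ne0: "v \<noteq> 0" if "v \<in> N" for v
    using that N by auto
  have facets: "{C. C facet_of P} = ?F ` ?N"
  proof (intro equalityI subsetI)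
    fix C assume "C \<in> {C. C facet_of P}"
    then have C: "C face_of P" "C \<noteq> {}" "aff_dim C = int DIM('a) - 1"
      using dimP by (auto simp: facet_of_def)
    have "convex C"
      using C face_of_imp_convex by blast
    then obtain x where x: "x \<in> rel_interior C"
      using C(2) rel_interior_eq_empty by blast
    then have xP: "x \<in> P" "x \<in> C"
      using C(1) face_of_imp_subset rel_interior_subset by blast+
    have "C \<noteq> P"
      using C dimP by auto
    then have "x \<notin> interior P"
      using face_of_disjoint_interior[OF C(1)] xP by auto
    \<comment> \<open>A relative interior point of a proper face is not interior to
      \<open>P\<close>, so some constraint is tight there. The corresponding face meets the relative
      interior of \<open>C\<close> and hence contains \<open>C\<close>; comparing dimensions forces
      equality.\<close>
    then obtain v where v: "v \<in> N" "v \<bullet> x = v \<bullet> v / 2"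
      using interior xP unfolding P by force
    then have "x \<in> ?F v"
      using xP by (auto simp: tight_face_def)
    then have CF: "C \<subseteq> ?F v"
      using subset_of_face_of[OF face[OF v(1)]] C(1) x face_of_imp_subset by blast
    have le: "aff_dim (?F v) \<le> aff_dim C"
      using aff_dim_subset_hyperplane_le[OF sub ne0[OF v(1)]] C by simp
    have "C face_of ?F v"
      using C(1) CF face[OF v(1)] face_of_face by blast
    then have "C = ?F v"
      using face_of_aff_dim_lt[of "?F v" C] le face_of_imp_convex[OF face[OF v(1)]] by force
    with C v show "C \<in> ?F ` ?N"
      by auto
  next
    fix C assume "C \<in> ?F ` ?N"
    then obtain v where v: "v \<in> ?N" "C = ?F v" by auto
    moreover have "?F v \<noteq> {}"
      using v by (auto simp: aff_dim_empty_eq)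
    ultimately show "C \<in> {C. C facet_of P}"
      using face dimP by (auto simp: facet_of_def)
  qed
  have "inj_on ?F ?N"
  proof (rule inj_onI)
    fix v w assume v: "v \<in> ?N" and w: "w \<in> ?N" and eq: "?F v = ?F w"
    have "{x. v \<bullet> x = v \<bullet> v / 2} = affine hull ?F v"
      using affine_hull_subset_hyperplane[OF sub, of v] v ne0 by auto
    also have "\<dots> = {x. w \<bullet> x = w \<bullet> w / 2}"
      unfolding eq using affine_hull_subset_hyperplane[OF sub, of w] w ne0 by auto
    finally have H: "\<And>x. v \<bullet> x = v \<bullet> v / 2 \<longleftrightarrow> w \<bullet> x = w \<bullet> w / 2"
      by blast
    \<comment> \<open>The midpoint of \<open>0\<close> and \<open>v\<close> lies on the bisector of
      \<open>v\<close>, hence on that of \<open>w\<close>, and conversely.\<close>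
    have "w \<bullet> v = w \<bullet> w" "v \<bullet> w = v \<bullet> v"
      using H[of "(1/2) *\<^sub>R v"] H[of "(1/2) *\<^sub>R w"] by auto
    then have "(v - w) \<bullet> (v - w) = 0"
      by (simp add: inner_diff_right inner_diff_left inner_commute)
    then show "v = w"
      by simp
  qed
  then have "surface_area P = (\<Sum>v\<in>?N. facet_area (?F v))"
    unfolding surface_area_def facets by (simp add: sum.reindex)
  also have "\<dots> = (\<Sum>v\<in>?N. measure lebesgue (prism (v /\<^sub>R norm v) (?F v)))"
    by (intro sum.cong refl facet_area_hyperplane[OF sub ne0]) auto
  also have "\<dots> = (\<Sum>v\<in>N. measure lebesgue (prism (v /\<^sub>R norm v) (?F v)))"
  proof (rule sum.mono_neutral_left)
    show "\<forall>v\<in>N - ?N. measure lebesgue (prism (v /\<^sub>R norm v) (?F v)) = 0"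
    proof
      fix v assume v: "v \<in> N - ?N"
      have "aff_dim (?F v) \<le> int DIM('a) - 1"
        using v by (intro aff_dim_subset_hyperplane_le[OF sub ne0]) auto
      then show "measure lebesgue (prism (v /\<^sub>R norm v) (?F v)) = 0"
        using v by (intro measure_prism_lowdim) auto
    qed
  qed (use N in auto)
  finally show ?thesis .
qed

section \<open>Prisms over plane hexagons and rectangles\<close>

text \<open>The model prism of height one over a plane region; every facet prism is an affine image
  of such a set.\<close>

definition slab :: "(real \<Rightarrow> real \<Rightarrow> bool) \<Rightarrow> (real^3) set" where
  "slab R = {z. R (z $ 1) (z $ 2) \<and> 0 \<le> z $ 3 \<and> z $ 3 \<le> 1}"

lemma inner_3: "x \<bullet> (y::real^3) = x $ 1 * y $ 1 + x $ 2 * y $ 2 + x $ 3 * y $ 3"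
  by (simp add: inner_vec_def sum_3)

text \<open>\<open>e1\<close>, \<open>e2\<close>, \<open>e3\<close> form the basis dual to
  \<open>p\<close>, \<open>q\<close>, \<open>v\<close>. The translation vector is therefore the
  point of the plane with coordinates \<open>u0\<close> and \<open>w0\<close>, and the first two
  slab coordinates are offsets from it.\<close>

lemma prism_plane_eq_image:
  fixes p q v e1 e2 e3 n :: "real^3"
  assumes inj: "\<And>x y. p \<bullet> x = p \<bullet> y \<Longrightarrow> q \<bullet> x = q \<bullet> y \<Longrightarrow> v \<bullet> x = v \<bullet> y \<Longrightarrow> x = y"
    and e1: "p \<bullet> e1 = 1" "q \<bullet> e1 = 0" "v \<bullet> e1 = 0"
    and e2: "p \<bullet> e2 = 0" "q \<bullet> e2 = 1" "v \<bullet> e2 = 0"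
    and e3: "p \<bullet> e3 = 0" "q \<bullet> e3 = 0" "v \<bullet> e3 = 1"
  shows "prism n {x. v \<bullet> x = h \<and> R (p \<bullet> x - u0) (q \<bullet> x - w0)}
    = (+) (u0 *\<^sub>R e1 + w0 *\<^sub>R e2 + h *\<^sub>R e3) `
      (\<lambda>z. z $ 1 *\<^sub>R e1 + z $ 2 *\<^sub>R e2 + z $ 3 *\<^sub>R n) ` slab R"
    (is "_ = (+) ?x0 ` ?L ` _")
proof (intro equalityI subsetI)
  fix y assume "y \<in> prism n {x. v \<bullet> x = h \<and> R (p \<bullet> x - u0) (q \<bullet> x - w0)}"
  then obtain x t where x: "v \<bullet> x = h" "R (p \<bullet> x - u0) (q \<bullet> x - w0)" "0 \<le> t" "t \<le> 1"
    and y: "y = x + t *\<^sub>R n"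
    by (auto simp: prism_def)
  let ?z = "vector [p \<bullet> x - u0, q \<bullet> x - w0, t] :: real^3"
  have "x = ?x0 + (p \<bullet> x - u0) *\<^sub>R e1 + (q \<bullet> x - w0) *\<^sub>R e2"
    using x by (intro inj) (simp_all add: inner_add_right e1 e2 e3)
  then have "y = ?x0 + (p \<bullet> x - u0) *\<^sub>R e1 + (q \<bullet> x - w0) *\<^sub>R e2 + t *\<^sub>R n"
    using y by metis
  then have "y = ?x0 + ?L ?z"
    by (simp only: vector_3 add.assoc)
  moreover have "?z \<in> slab R"
    using x by (simp add: slab_def vector_3)
  ultimately show "y \<in> (+) ?x0 ` ?L ` slab R"
    by blast
next
  fix y assume "y \<in> (+) ?x0 ` ?L ` slab R"
  then obtain z where z: "z \<in> slab R" "y = ?x0 + ?L z"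
    by blast
  let ?x = "?x0 + z $ 1 *\<^sub>R e1 + z $ 2 *\<^sub>R e2"
  have "v \<bullet> ?x = h" "p \<bullet> ?x - u0 = z $ 1" "q \<bullet> ?x - w0 = z $ 2"
    by (simp_all add: inner_add_right e1 e2 e3)
  moreover have "y = ?x + z $ 3 *\<^sub>R n"
    using z by (simp add: add.assoc)
  ultimately show "y \<in> prism n {x. v \<bullet> x = h \<and> R (p \<bullet> x - u0) (q \<bullet> x - w0)}"
    using z(1) unfolding prism_def slab_def by fastforce
qed

text \<open>In the coordinates \<open>M *v x\<close> the linear map \<open>L\<close> from slab to
  prism is upper triangular with diagonal \<open>1\<close>, \<open>1\<close>,
  \<open>v \<bullet> n = norm v\<close>. This determines its Jacobian.\<close>

lemma measure_prism_plane:
  fixes p q v :: "real^3"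
  defines "M \<equiv> vector [p, q, v] :: real^3^3"
  assumes D: "det M \<noteq> 0" and S: "slab R \<in> lmeasurable"
  shows "measure lebesgue (prism (v /\<^sub>R norm v) {x. v \<bullet> x = h \<and> R (p \<bullet> x - u0) (q \<bullet> x - w0)})
    = norm v / \<bar>det M\<bar> * measure lebesgue (slab R)"
proof -
  define n where "n = v /\<^sub>R norm v"
  have Mv: "M *v x = vector [p \<bullet> x, q \<bullet> x, v \<bullet> x]" for x
    by (simp add: vec_eq_iff forall_3 matrix_vector_mul_component M_def vector_3)
  obtain M' where "M ** M' = mat 1" "M' ** M = mat 1"
    using D by (auto simp: invertible_def simp flip: invertible_det_nz)
  then have inv: "M *v (M' *v x) = x" "M' *v (M *v x) = x" for x
    by (simp_all add: matrix_vector_mul_assoc)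
  have inj: "x = y" if "p \<bullet> x = p \<bullet> y" "q \<bullet> x = q \<bullet> y" "v \<bullet> x = v \<bullet> y" for x y
    using that by (metis Mv inv(2))
  define e where "e a b c = M' *v vector [a, b, c]" for a b c
  have e: "p \<bullet> e a b c = a" "q \<bullet> e a b c = b" "v \<bullet> e a b c = c" for a b c
    using inv(1)[of "vector [a, b, c]"] by (simp_all add: Mv e_def vec_eq_iff forall_3 vector_3)
  define L where "L z = z $ 1 *\<^sub>R e 1 0 0 + z $ 2 *\<^sub>R e 0 1 0 + z $ 3 *\<^sub>R n" for z :: "real^3"
  have "linear L"
    by (rule linearI) (simp_all add: L_def algebra_simps)
  have "v \<noteq> 0"
    using D by (auto simp: M_def det_3 vector_3)
  then have vn: "v \<bullet> n = norm v"
    by (simp add: n_def dot_square_norm power2_eq_square)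
  have "(M ** matrix L) $ i $ j = (M *v L (axis j 1)) $ i" for i j
    by (simp add: matrix_matrix_mult_def matrix_vector_mult_def matrix_def)
  moreover have "L (axis 1 1) = e 1 0 0" "L (axis 2 1) = e 0 1 0" "L (axis 3 1) = n"
    by (simp_all add: L_def axis_def)
  ultimately have "det (M ** matrix L) = norm v"
    by (simp add: det_3 Mv vector_3 e vn)
  then have "\<bar>det M\<bar> * \<bar>det (matrix L)\<bar> = norm v"
    by (metis abs_mult abs_norm_cancel det_mul)
  then have det: "\<bar>det (matrix L)\<bar> = norm v / \<bar>det M\<bar>"
    using D by (simp add: eq_divide_eq mult.commute)
  have "prism n {x. v \<bullet> x = h \<and> R (p \<bullet> x - u0) (q \<bullet> x - w0)}
      = (+) (u0 *\<^sub>R e 1 0 0 + w0 *\<^sub>R e 0 1 0 + h *\<^sub>R e 0 0 1) ` L ` slab R"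
    unfolding L_def by (rule prism_plane_eq_image[OF inj e e e])
  then show ?thesis
    using measure_linear_image[OF \<open>linear L\<close> S]
    by (simp only: measure_translation n_def[symmetric] det)
qed

section \<open>Volumes of the model prisms over rectangles, triangles and hexagons\<close>

lemma slab_rectangle:
  fixes c d :: real
  assumes "c \<ge> 0" "d \<ge> 0"
  shows "slab (\<lambda>u w. \<bar>u\<bar> \<le> c / 2 \<and> \<bar>w\<bar> \<le> d / 2) \<in> lmeasurable"
    and "measure lebesgue (slab (\<lambda>u w. \<bar>u\<bar> \<le> c / 2 \<and> \<bar>w\<bar> \<le> d / 2)) = c * d"
proof -
  let ?l = "vector [- c / 2, - d / 2, 0] :: real^3" and ?u = "vector [c / 2, d / 2, 1] :: real^3"
  have eq: "slab (\<lambda>u w. \<bar>u\<bar> \<le> c / 2 \<and> \<bar>w\<bar> \<le> d / 2) = cbox ?l ?u"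
    by (auto simp: slab_def mem_box_cart forall_3 vector_3)
  show "slab (\<lambda>u w. \<bar>u\<bar> \<le> c / 2 \<and> \<bar>w\<bar> \<le> d / 2) \<in> lmeasurable"
    unfolding eq by simp
  have "?l \<in> cbox ?l ?u"
    using assms by (simp add: mem_box_cart forall_3 vector_3)
  then have "measure lborel (cbox ?l ?u) = (\<Prod>i\<in>UNIV. ?u $ i - ?l $ i)"
    by (intro content_cbox_cart) blast
  also have "\<dots> = c * d"
    unfolding UNIV_3 by (simp add: vector_3)
  finally show "measure lebesgue (slab (\<lambda>u w. \<bar>u\<bar> \<le> c / 2 \<and> \<bar>w\<bar> \<le> d / 2)) = c * d"
    unfolding eq by (simp only: measure_completion borel_closed closed_cbox sets_lborel)
qed

lemma measure_slab_reflect: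
  fixes S :: "(real^3) set"
  assumes "S \<in> lmeasurable"
  shows "(\<lambda>z. vector [r - z $ 1, s - z $ 2, z $ 3] :: real^3) ` S \<in> lmeasurable"
    and "measure lebesgue ((\<lambda>z. vector [r - z $ 1, s - z $ 2, z $ 3] :: real^3) ` S) = measure lebesgue S"
proof -
  define L where "L z = (vector [- z $ 1, - z $ 2, z $ 3] :: real^3)" for z :: "real^3"
  have eq: "(\<lambda>z. vector [r - z $ 1, s - z $ 2, z $ 3] :: real^3) ` S = (+) (vector [r, s, 0]) ` L ` S"
    unfolding image_image by (intro image_cong refl) (simp add: vec_eq_iff forall_3 L_def vector_3)
  have "linear L"
    by (rule linearI) (simp_all add: L_def vec_eq_iff forall_3 vector_3)
  moreover have "det (matrix L) = 1"
    by (simp add: det_3 matrix_def L_def vector_3 axis_def)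
  ultimately have "L ` S \<in> lmeasurable" "measure lebesgue (L ` S) = measure lebesgue S"
    using assms measurable_linear_image[of L S] measure_linear_image[of L S] by simp_all
  then show "(\<lambda>z. vector [r - z $ 1, s - z $ 2, z $ 3] :: real^3) ` S \<in> lmeasurable"
    "measure lebesgue ((\<lambda>z. vector [r - z $ 1, s - z $ 2, z $ 3] :: real^3) ` S) = measure lebesgue S"
    unfolding eq by (simp_all only: measurable_translation measure_translation)
qed

lemma reflect_image_slab:
  "(\<lambda>z. vector [r - z $ 1, s - z $ 2, z $ 3] :: real^3) ` slab R = slab (\<lambda>u w. R (r - u) (s - w))"
proof (intro equalityI subsetI)
  fix y assume "y \<in> slab (\<lambda>u w. R (r - u) (s - w))"
  then have "(vector [r - y $ 1, s - y $ 2, y $ 3] :: real^3) \<in> slab R"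
    by (simp add: slab_def vector_3)
  moreover have "y = (\<lambda>z. vector [r - z $ 1, s - z $ 2, z $ 3] :: real^3) (vector [r - y $ 1, s - y $ 2, y $ 3] :: real^3)"
    by (simp add: vec_eq_iff forall_3 vector_3)
  ultimately show "y \<in> (\<lambda>z. vector [r - z $ 1, s - z $ 2, z $ 3] :: real^3) ` slab R"
    by blast
qed (auto simp: slab_def vector_3)

text \<open>Half turns supply the second triangle of a square and the opposite corner of a
  hexagon.\<close>

lemma measure_slab_half_turn:
  assumes "slab R \<in> lmeasurable"
  shows "slab (\<lambda>u w. R (r - u) (s - w)) \<in> lmeasurable"
    and "measure lebesgue (slab (\<lambda>u w. R (r - u) (s - w))) = measure lebesgue (slab R)"
  using measure_slab_reflect[OF assms, of r s] unfolding reflect_image_slab by blast+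

lemma negligible_slab_diagonal:
  assumes "\<And>u w. R u w \<Longrightarrow> u + w = g"
  shows "negligible (slab R)"
proof -
  have "slab R \<subseteq> {z. vector [1, 1, 0] \<bullet> z = g}"
    using assms by (auto simp: slab_def inner_3 vector_3)
  moreover have "vector [1, 1, 0] \<noteq> (0 :: real^3)"
    by (simp add: vec_eq_iff forall_3 vector_3)
  ultimately show ?thesis
    using negligible_hyperplane negligible_subset by blast
qed

lemma slab_Int: "slab R \<inter> slab R' = slab (\<lambda>u w. R u w \<and> R' u w)"
  by (auto simp: slab_def)

lemma slab_Un: "slab R \<union> slab R' = slab (\<lambda>u w. R u w \<or> R' u w)"
  by (auto simp: slab_def)

lemma slab_lmeasurable_le:
  assumes "\<And>u w. R u w \<Longrightarrow> \<bar>u\<bar> \<le> c \<and> \<bar>w\<bar> \<le> c"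
    and "closed (slab R)"
  shows "slab R \<in> lmeasurable"
proof -
  have "slab R \<subseteq> cbox (vector [- c, - c, 0]) (vector [c, c, 1])"
    using assms(1) by (force simp: slab_def mem_box_cart forall_3 vector_3)
  then have "bounded (slab R)"
    using bounded_cbox bounded_subset by blast
  then show ?thesis
    using assms(2) by (simp add: lmeasurable_compact compact_eq_bounded_closed)
qed

text \<open>A square of side \<open>g\<close> is the union of the triangle and its half turn, which
  overlap only in the diagonal.\<close>

lemma slab_triangle:
  fixes g :: real
  assumes g: "g \<ge> 0"
  defines "T \<equiv> \<lambda>u w. 0 \<le> u \<and> 0 \<le> w \<and> u + w \<le> g"
  shows "slab T \<in> lmeasurable" and "measure lebesgue (slab T) = g\<^sup>2 / 2"
proof -
  have "closed (slab T)"
    unfolding slab_def T_def by (intro closed_Collect_conj closed_Collect_le continuous_intros)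
  then show T: "slab T \<in> lmeasurable"
    by (intro slab_lmeasurable_le[of T g]) (auto simp: T_def)
  let ?T' = "\<lambda>u w. T (g - u) (g - w)"
  let ?S = "\<lambda>u w. 0 \<le> u \<and> u \<le> g \<and> 0 \<le> w \<and> w \<le> g"
  note T' = measure_slab_half_turn[OF T, of g g]
  have S: "measure lebesgue (slab ?S) = g\<^sup>2"
  proof -
    have "?S = (\<lambda>u w. \<bar>g / 2 - u\<bar> \<le> g / 2 \<and> \<bar>g / 2 - w\<bar> \<le> g / 2)"
      by (intro ext) argo
    then show ?thesis
      using slab_rectangle[OF g g] measure_slab_half_turn(2)[of "\<lambda>u w. \<bar>u\<bar> \<le> g / 2 \<and> \<bar>w\<bar> \<le> g / 2" "g/2" "g/2"]
      by (simp add: power2_eq_square)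
  qed
  have "negligible (slab T \<inter> slab ?T')"
    unfolding slab_Int by (rule negligible_slab_diagonal[of _ g]) (auto simp: T_def)
  moreover have "slab T \<union> slab ?T' = slab ?S"
    unfolding slab_Un by (rule arg_cong[of _ _ slab]) (auto simp: T_def fun_eq_iff)
  ultimately have "measure lebesgue (slab ?S) = measure lebesgue (slab T) + measure lebesgue (slab ?T')"
    using T T' measure_Un3[of "slab T" lebesgue "slab ?T'"] by (simp add: negligible_imp_measure0)
  with S T' show "measure lebesgue (slab T) = g\<^sup>2 / 2"
    by simp
qed

text \<open>Cutting two opposite corner triangles with legs \<open>\<gamma>\<close> off a rectangle
  with sides \<open>\<alpha> + \<gamma>\<close> and \<open>\<beta> + \<gamma>\<close> leaves the
  hexagon, of area \<open>(\<alpha> + \<gamma>) * (\<beta> + \<gamma>) - \<gamma>^2\<close>.\<close>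

lemma slab_hexagon:
  fixes \<alpha> \<beta> \<gamma> :: real
  assumes nonneg: "\<alpha> \<ge> 0" "\<beta> \<ge> 0" "\<gamma> \<ge> 0"
  defines "H \<equiv> \<lambda>u w. \<bar>u\<bar> \<le> (\<alpha> + \<gamma>) / 2 \<and> \<bar>w\<bar> \<le> (\<beta> + \<gamma>) / 2 \<and> \<bar>u + w\<bar> \<le> (\<alpha> + \<beta>) / 2"
  shows "slab H \<in> lmeasurable"
    and "measure lebesgue (slab H) = \<alpha> * \<beta> + \<alpha> * \<gamma> + \<beta> * \<gamma>"
proof -
  have "closed (slab H)"
    unfolding slab_def H_def by (intro closed_Collect_conj closed_Collect_le continuous_intros)
  then show H: "slab H \<in> lmeasurable"
    using nonneg by (intro slab_lmeasurable_le[of H "(\<alpha> + \<beta> + \<gamma>) / 2"]) (auto simp: H_def)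
  let ?r = "(\<alpha> + \<gamma>) / 2" and ?s = "(\<beta> + \<gamma>) / 2"
  let ?R = "\<lambda>u w. \<bar>u\<bar> \<le> ?r \<and> \<bar>w\<bar> \<le> ?s"
  let ?T = "\<lambda>u w. 0 \<le> u \<and> 0 \<le> w \<and> u + w \<le> \<gamma>"
  let ?T1 = "\<lambda>u w. ?T (?r - u) (?s - w)"
  let ?T2 = "\<lambda>u w. ?T1 (0 - u) (0 - w)"
  note T = slab_triangle[OF nonneg(3)]
  note T1 = measure_slab_half_turn[OF T(1), of ?r ?s]
  note T2 = measure_slab_half_turn[OF T1(1), of 0 0]
  have "measure lebesgue (slab ?R) =
      measure lebesgue (slab H) + measure lebesgue (slab ?T1) + measure lebesgue (slab ?T2)"
  proof (rule measure_Un3_negligible[OF H T1(1) T2(1)])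
    show "negligible (slab H \<inter> slab ?T1)"
      unfolding slab_Int by (rule negligible_slab_diagonal[of _ "(\<alpha> + \<beta>) / 2"]) (unfold H_def, argo)
    show "negligible (slab H \<inter> slab ?T2)"
      unfolding slab_Int by (rule negligible_slab_diagonal[of _ "- (\<alpha> + \<beta>) / 2"]) (unfold H_def, argo)
    \<comment> \<open>In both corners \<open>(\<alpha> + \<beta>) / 2 \<le> u + w \<le> - (\<alpha>
      + \<beta>) / 2\<close>, so they meet only if \<open>\<alpha> = \<beta> = 0\<close>, and then
      only on a line.\<close>
    show "negligible (slab ?T1 \<inter> slab ?T2)"
      unfolding slab_Int using nonneg
      by (intro negligible_slab_diagonal[of _ "(\<alpha> + \<beta>) / 2"]) argo
    have "(H u w \<or> ?T1 u w) \<or> ?T2 u w \<longleftrightarrow> ?R u w" for u w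
      using nonneg unfolding H_def by argo
    then show "slab H \<union> slab ?T1 \<union> slab ?T2 = slab ?R"
      unfolding slab_Un by presburger
  qed
  moreover have "measure lebesgue (slab ?R) = (\<alpha> + \<gamma>) * (\<beta> + \<gamma>)"
    using nonneg by (intro slab_rectangle) auto
  ultimately show "measure lebesgue (slab H) = \<alpha> * \<beta> + \<alpha> * \<gamma> + \<beta> * \<gamma>"
    using T T1 T2 by (simp add: algebra_simps power2_eq_square)
qed

lemma prism_uminus: "prism (- n) (uminus ` S) = uminus ` prism n S"
proof (intro equalityI subsetI)
  fix y assume "y \<in> prism (- n) (uminus ` S)"
  then obtain x t where "x \<in> S" "t \<in> {0..1}" "y = - (x + t *\<^sub>R n)"
    by (auto simp: prism_def)
  then show "y \<in> uminus ` prism n S"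
    unfolding prism_def by blast
next
  fix y assume "y \<in> uminus ` prism n S"
  then obtain x t where "x \<in> S" "t \<in> {0..1}" "y = - x + t *\<^sub>R (- n)"
    by (auto simp: prism_def)
  then show "y \<in> prism (- n) (uminus ` S)"
    unfolding prism_def by blast
qed

lemma measure_uminus_image:
  fixes S :: "'a::euclidean_space set"
  shows "measure lebesgue (uminus ` S) = measure lebesgue S"
  using measure_lebesgue_affine[of "- 1" 0 S] by simp

section \<open>The Voronoi cell of an obtuse superbase\<close>

lemma integer_cut_inequality:
  fixes z0 z1 z2 z3 :: real and r01 r02 r03 r12 r13 r23 :: real
  defines "lin \<equiv> \<lambda>(m0::int) (m1::int) (m2::int) (m3::int). m0 * z0 + m1 * z1 + m2 * z2 + m3 * z3"
    and "w \<equiv> \<lambda>(m0::int) (m1::int) (m2::int) (m3::int). r01 * \<bar>m0 - m1\<bar> + r02 * \<bar>m0 - m2\<bar> + r03 * \<bar>m0 - m3\<bar>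
      + r12 * \<bar>m1 - m2\<bar> + r13 * \<bar>m1 - m3\<bar> + r23 * \<bar>m2 - m3\<bar>"
  assumes cut: "\<And>s0 s1 s2 s3. {s0, s1, s2, s3} \<subseteq> {0, 1} \<Longrightarrow> lin s0 s1 s2 s3 \<le> w s0 s1 s2 s3 / 2"
  shows "{m0, m1, m2, m3} \<subseteq> {0..int n} \<Longrightarrow> lin m0 m1 m2 m3 \<le> w m0 m1 m2 m3 / 2"
proof (induction n arbitrary: m0 m1 m2 m3)
  case 0
  then show ?case by (simp add: lin_def w_def)
next
  case (Suc n)
  \<comment> \<open>\<open>s\<close> is the indicator of the top level set; removing it splits both sides additively.\<close>
  define s where "s m = (if m = int (Suc n) then 1 else 0 :: int)" for m
  define t where "t m = m - s m" for m
  have t: "t m \<in> {0..int n}" if "m \<in> {0..int (Suc n)}" for m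
    using that by (auto simp: s_def t_def)
  have split: "\<bar>real_of_int m - m'\<bar> = \<bar>real_of_int (t m) - t m'\<bar> + \<bar>real_of_int (s m) - s m'\<bar>"
    if "m \<in> {0..int (Suc n)}" "m' \<in> {0..int (Suc n)}" for m m'
    using that by (auto simp: s_def t_def)
  have "lin (t m0) (t m1) (t m2) (t m3) \<le> w (t m0) (t m1) (t m2) (t m3) / 2"
    using Suc.prems t by (intro Suc.IH) auto
  moreover have "lin (s m0) (s m1) (s m2) (s m3) \<le> w (s m0) (s m1) (s m2) (s m3) / 2"
    by (rule cut) (auto simp: s_def)
  moreover have "lin m0 m1 m2 m3 = lin (t m0) (t m1) (t m2) (t m3) + lin (s m0) (s m1) (s m2) (s m3)"
    by (simp add: lin_def t_def algebra_simps)
  moreover have "w m0 m1 m2 m3 = w (t m0) (t m1) (t m2) (t m3) + w (s m0) (s m1) (s m2) (s m3)"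
    using Suc.prems by (simp add: w_def split algebra_simps)
  ultimately show ?case
    by linarith
qed

text \<open>Regard \<open>0\<close>, \<open>i\<close>, \<open>j\<close>, \<open>k\<close> as
  multipliers of \<open>b0\<close>, ..., \<open>b3\<close>, where \<open>b0\<close> pairs with the
  point to \<open>- (z1 + z2 + z3)\<close>. Adding a constant to all four multipliers changes
  neither side, so subtracting their minimum \<open>L\<close> makes
  \<open>integer_cut_inequality\<close> applicable.\<close>

lemma selling_form_ge:
  fixes z1 z2 z3 a b c d e f :: real and i j k :: int
  assumes nonneg: "a \<ge> 0" "b \<ge> 0" "c \<ge> 0" "d \<ge> 0" "e \<ge> 0" "f \<ge> 0"
    and "\<bar>z1\<bar> \<le> (a + d + e) / 2" "\<bar>z2\<bar> \<le> (b + d + f) / 2" "\<bar>z3\<bar> \<le> (c + e + f) / 2"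
    and "\<bar>z1 + z2\<bar> \<le> (a + b + e + f) / 2" "\<bar>z1 + z3\<bar> \<le> (a + c + d + f) / 2"
    and "\<bar>z2 + z3\<bar> \<le> (b + c + d + e) / 2" "\<bar>z1 + z2 + z3\<bar> \<le> (a + b + c) / 2"
  shows "i * z1 + j * z2 + k * z3
    \<le> (a * i\<^sup>2 + b * j\<^sup>2 + c * k\<^sup>2 + d * (i - j)\<^sup>2 + e * (i - k)\<^sup>2 + f * (j - k)\<^sup>2) / 2"
proof -
  define L where "L = min 0 (min i (min j k))"
  define M where "M = max 0 (max i (max j k))"
  define n where "n = nat (M - L)"
  have L: "L \<le> 0" "L \<le> i" "L \<le> j" "L \<le> k"
    by (simp_all add: L_def)
  have "0 \<le> M" "i \<le> M" "j \<le> M" "k \<le> M"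
    by (simp_all add: M_def)
  then have n: "0 - L \<le> n" "i - L \<le> n" "j - L \<le> n" "k - L \<le> n"
    using L by (simp_all add: n_def)
  let ?m0 = "0 - L" and ?m1 = "i - L" and ?m2 = "j - L" and ?m3 = "k - L"
  have bounds: "z1 \<le> (a + d + e) / 2" "- z1 \<le> (a + d + e) / 2"
    "z2 \<le> (b + d + f) / 2" "- z2 \<le> (b + d + f) / 2"
    "z3 \<le> (c + e + f) / 2" "- z3 \<le> (c + e + f) / 2"
    "z1 + z2 \<le> (a + b + e + f) / 2" "- (z1 + z2) \<le> (a + b + e + f) / 2"
    "z1 + z3 \<le> (a + c + d + f) / 2" "- (z1 + z3) \<le> (a + c + d + f) / 2"
    "z2 + z3 \<le> (b + c + d + e) / 2" "- (z2 + z3) \<le> (b + c + d + e) / 2"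
    "z1 + z2 + z3 \<le> (a + b + c) / 2" "- (z1 + z2 + z3) \<le> (a + b + c) / 2"
    using assms by (simp_all only: abs_le_iff)
  have "?m0 * (- (z1 + z2 + z3)) + ?m1 * z1 + ?m2 * z2 + ?m3 * z3
    \<le> (a * \<bar>real_of_int ?m0 - ?m1\<bar> + b * \<bar>real_of_int ?m0 - ?m2\<bar> + c * \<bar>real_of_int ?m0 - ?m3\<bar>
      + d * \<bar>real_of_int ?m1 - ?m2\<bar> + e * \<bar>real_of_int ?m1 - ?m3\<bar> + f * \<bar>real_of_int ?m2 - ?m3\<bar>) / 2"
  proof (rule integer_cut_inequality[where n = n])
    fix s0 s1 s2 s3 :: int
    assume "{s0, s1, s2, s3} \<subseteq> {0, 1}"
    \<comment> \<open>Of the sixteen cases the two constant labellings give \<open>0\<close>; the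
      other fourteen are the seven bounds with either sign.\<close>
    then have "s0 = 0 \<or> s0 = 1" "s1 = 0 \<or> s1 = 1" "s2 = 0 \<or> s2 = 1" "s3 = 0 \<or> s3 = 1" by auto
    then show "s0 * - (z1 + z2 + z3) + s1 * z1 + s2 * z2 + s3 * z3
      \<le> (a * \<bar>real_of_int s0 - s1\<bar> + b * \<bar>real_of_int s0 - s2\<bar> + c * \<bar>real_of_int s0 - s3\<bar>
        + d * \<bar>real_of_int s1 - s2\<bar> + e * \<bar>real_of_int s1 - s3\<bar> + f * \<bar>real_of_int s2 - s3\<bar>) / 2"
      using bounds
      by (elim disjE; hypsubst; simp only: of_int_0 of_int_1 mult_zero_left mult_1 diff_self diff_0
          diff_0_right abs_zero abs_one abs_neg_one mult_1_right mult_zero_right; argo)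
  qed (use L n in simp)
  also have "\<dots> = (a * \<bar>i\<bar> + b * \<bar>j\<bar> + c * \<bar>k\<bar> + d * \<bar>real_of_int i - j\<bar> + e * \<bar>real_of_int i - k\<bar> + f * \<bar>real_of_int j - k\<bar>) / 2"
    by simp
  also have "\<dots> \<le> (a * i\<^sup>2 + b * j\<^sup>2 + c * k\<^sup>2 + d * (i - j)\<^sup>2 + e * (i - k)\<^sup>2 + f * (j - k)\<^sup>2) / 2"
  proof -
    have "\<bar>m\<bar> \<le> m\<^sup>2" for m :: int
    proof (cases "m = 0")
      case False
      then have "\<bar>m\<bar> * 1 \<le> \<bar>m\<bar> * \<bar>m\<bar>"
        by (intro mult_left_mono) auto
      then show ?thesis
        by (simp add: power2_eq_square)
    qed simp
    then have "real_of_int \<bar>m\<bar> \<le> real_of_int m ^ 2" for m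
      by (metis of_int_le_iff of_int_power)
    from this[of i] this[of j] this[of k] this[of "i - j"] this[of "i - k"] this[of "j - k"]
    show ?thesis
      using nonneg by (intro divide_right_mono add_mono mult_left_mono) simp_all
  qed
  finally show ?thesis
    by (simp add: algebra_simps)
qed

text \<open>Half the surface area of the cell times the covolume \<open>sqrt (det A)\<close>, with
  one summand for each pair of opposite facets.\<close>

definition voronoi_area_form :: "selling \<Rightarrow> real" where
  "voronoi_area_form = (\<lambda>(a, b, c, d, e, f).
     a * f * sqrt (b + c + d + e) + b * e * sqrt (a + c + d + f) + c * d * sqrt (a + b + e + f)
     + sqrt (a + b + c) * (d * e + d * f + e * f) + sqrt (a + d + e) * (b * c + b * f + c * f)
     + sqrt (b + d + f) * (a * c + a * e + c * e) + sqrt (c + e + f) * (a * b + a * d + b * d))"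

section \<open>The cell in the coordinates of a fixed obtuse superbase\<close>

locale selling_basis =
  fixes B :: "real^3^3" and a b c d e f :: real
  assumes nonneg: "a \<ge> 0" "b \<ge> 0" "c \<ge> 0" "d \<ge> 0" "e \<ge> 0" "f \<ge> 0"
    and gram: "has_selling_parameters B (a, b, c, d, e, f)"
    and det_pos: "det (selling_matrix (a, b, c, d, e, f)) > 0"
begin

definition comb :: "int \<times> int \<times> int \<Rightarrow> real^3" where
  "comb = (\<lambda>(i, j, k). i *\<^sub>R B $ 1 + j *\<^sub>R B $ 2 + k *\<^sub>R B $ 3)"

text \<open>One vector of each opposite pair: complementary index sets give opposite sums, so only
  the sets that avoid the index 0 are listed.\<close>

definition relevant :: "(int \<times> int \<times> int) set" where
  "relevant = {(1,0,0), (0,1,0), (0,0,1), (1,1,0), (1,0,1), (0,1,1), (1,1,1)}"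

abbreviation "V \<equiv> voronoi_cell (lattice_of B)"

lemma gram_entries:
  "B $ 1 \<bullet> B $ 1 = a + d + e" "B $ 2 \<bullet> B $ 2 = b + d + f" "B $ 3 \<bullet> B $ 3 = c + e + f"
  "B $ 1 \<bullet> B $ 2 = - d" "B $ 2 \<bullet> B $ 1 = - d" "B $ 1 \<bullet> B $ 3 = - e" "B $ 3 \<bullet> B $ 1 = - e"
  "B $ 2 \<bullet> B $ 3 = - f" "B $ 3 \<bullet> B $ 2 = - f"
  using gram by (simp_all add: has_selling_parameters_def vector_3)

lemma abs_det_basis: "\<bar>det B\<bar> = sqrt (det (selling_matrix (a, b, c, d, e, f)))"
proof -
  have "selling_matrix (a, b, c, d, e, f) = B ** transpose B"
    using gram by (simp add: vec_eq_iff has_selling_parameters_def matrix_matrix_mult_def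
        transpose_def inner_vec_def)
  then have "det (selling_matrix (a, b, c, d, e, f)) = (det B)\<^sup>2"
    by (simp add: det_mul det_transpose power2_eq_square)
  then show ?thesis
    by simp
qed

lemma det_basis_nonzero: "det B \<noteq> 0"
  using abs_det_basis det_pos by auto

text \<open>Selling's formula: the sum of the \<rho>ij times the squared differences of the
  multipliers, \<open>b0\<close> having multiplier 0.\<close>

lemma comb_inner_self:
  "comb (i, j, k) \<bullet> comb (i, j, k)
    = a * i\<^sup>2 + b * j\<^sup>2 + c * k\<^sup>2 + d * (i - j)\<^sup>2 + e * (i - k)\<^sup>2 + f * (j - k)\<^sup>2"
  by (simp add: comb_def inner_add_left inner_add_right gram_entries)
    (simp add: algebra_simps power2_eq_square)

lemma comb_inner: "comb (i, j, k) \<bullet> x = i * (B $ 1 \<bullet> x) + j * (B $ 2 \<bullet> x) + k * (B $ 3 \<bullet> x)"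
  by (simp add: comb_def inner_add_left)

lemma comb_uminus: "comb (- i, - j, - k) = - comb (i, j, k)"
  by (simp add: comb_def)

text \<open>The map is \<open>transpose B\<close> on integer vectors, and \<open>B\<close> is
  invertible. This keeps the fourteen bisecting vectors distinct and nonzero.\<close>

lemma inj_comb: "inj comb"
proof (rule injI)
  fix m m' assume eq: "comb m = comb m'"
  let ?r = "\<lambda>(i, j, k). vector [real_of_int i, real_of_int j, real_of_int k] :: real^3"
  have "comb m = transpose B *v ?r m" for m
    by (simp add: comb_def vec_eq_iff matrix_vector_mult_def transpose_def sum_3 vector_3
        algebra_simps split: prod.split)
  then have "transpose B *v ?r m = transpose B *v ?r m'"
    using eq by simp
  then have "?r m = ?r m'"
    by (rule injD[OF inj_matrix_vector_mult, rotated])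
      (use det_basis_nonzero in \<open>simp add: invertible_det_nz\<close>)
  then show "m = m'"
    by (simp add: vec_eq_iff forall_3 vector_3 split: prod.splits)
qed

lemma voronoi_cell_lattice: "V = {x. \<forall>m. comb m \<bullet> x \<le> comb m \<bullet> comb m / 2}"
proof -
  have "dist x 0 \<le> dist x l \<longleftrightarrow> l \<bullet> x \<le> l \<bullet> l / 2" for x l :: "real^3"
  proof -
    have "dist x 0 \<le> dist x l \<longleftrightarrow> x \<bullet> x \<le> (x - l) \<bullet> (x - l)"
      by (simp add: dist_norm norm_le)
    then show ?thesis
      by (auto simp: inner_diff_left inner_diff_right inner_commute)
  qed
  moreover have "lattice_of B = range comb"
  proof (intro equalityI subsetI)
    fix l assume "l \<in> lattice_of B"
    then obtain m :: "3 \<Rightarrow> int" where "l = comb (m 1, m 2, m 3)"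
      by (auto simp: lattice_of_def comb_def sum_3)
    then show "l \<in> range comb"
      by blast
  next
    fix l assume "l \<in> range comb"
    then obtain i j k where "l = comb (i, j, k)"
      by auto
    then have "l = (\<Sum>r\<in>UNIV. of_int (m r) *\<^sub>R B $ r)"
      if "m = (\<lambda>r. if r = 1 then i else if r = 2 then j else k)" for m
      using that by (simp add: comb_def sum_3)
    then show "l \<in> lattice_of B"
      unfolding lattice_of_def by blast
  qed
  ultimately show ?thesis
    by (auto simp: voronoi_cell_def)
qed

text \<open>All lattice inequalities follow from these seven by \<open>selling_form_ge\<close>;
  conversely each combines the inequalities of one lattice vector and its negative.\<close>

lemma mem_voronoi_cell:
  defines "y \<equiv> \<lambda>x i. B $ i \<bullet> x"
  shows "x \<in> V \<longleftrightarrow>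
    \<bar>y x 1\<bar> \<le> (a + d + e) / 2 \<and> \<bar>y x 2\<bar> \<le> (b + d + f) / 2 \<and> \<bar>y x 3\<bar> \<le> (c + e + f) / 2 \<and>
    \<bar>y x 1 + y x 2\<bar> \<le> (a + b + e + f) / 2 \<and> \<bar>y x 1 + y x 3\<bar> \<le> (a + c + d + f) / 2 \<and>
    \<bar>y x 2 + y x 3\<bar> \<le> (b + c + d + e) / 2 \<and> \<bar>y x 1 + y x 2 + y x 3\<bar> \<le> (a + b + c) / 2"
    (is "_ \<longleftrightarrow> ?ineqs")
proof
  assume "x \<in> V"
  then have V: "comb m \<bullet> x \<le> comb m \<bullet> comb m / 2" for m
    unfolding voronoi_cell_lattice by blast
  have "\<bar>comb (i, j, k) \<bullet> x\<bar> \<le> comb (i, j, k) \<bullet> comb (i, j, k) / 2" for i j k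
  proof -
    have "- (comb (i, j, k) \<bullet> x) \<le> comb (i, j, k) \<bullet> comb (i, j, k) / 2"
      using V[of "(- i, - j, - k)"]
      by (simp only: comb_uminus inner_minus_left inner_minus_right minus_minus)
    with V[of "(i, j, k)"] show ?thesis
      by (simp only: abs_le_iff)
  qed
  then have *: "\<bar>i * y x 1 + j * y x 2 + k * y x 3\<bar>
    \<le> (a * i\<^sup>2 + b * j\<^sup>2 + c * k\<^sup>2 + d * (i - j)\<^sup>2 + e * (i - k)\<^sup>2 + f * (j - k)\<^sup>2) / 2" for i j k :: int
    unfolding y_def comb_inner_self[symmetric] comb_inner[symmetric] by blast
  have "\<bar>y x 1\<bar> \<le> (a + d + e) / 2" using *[of 1 0 0] by simp
  moreover have "\<bar>y x 2\<bar> \<le> (b + d + f) / 2" using *[of 0 1 0] by simp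
  moreover have "\<bar>y x 3\<bar> \<le> (c + e + f) / 2" using *[of 0 0 1] by simp
  moreover have "\<bar>y x 1 + y x 2\<bar> \<le> (a + b + e + f) / 2" using *[of 1 1 0] by simp
  moreover have "\<bar>y x 1 + y x 3\<bar> \<le> (a + c + d + f) / 2" using *[of 1 0 1] by simp
  moreover have "\<bar>y x 2 + y x 3\<bar> \<le> (b + c + d + e) / 2" using *[of 0 1 1] by simp
  moreover have "\<bar>y x 1 + y x 2 + y x 3\<bar> \<le> (a + b + c) / 2" using *[of 1 1 1] by simp
  ultimately show ?ineqs
    by blast
next
  assume "?ineqs"
  then have "comb (i, j, k) \<bullet> x \<le> comb (i, j, k) \<bullet> comb (i, j, k) / 2" for i j k
    unfolding comb_inner[of _ _ _ x] comb_inner_self y_def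
    by (intro selling_form_ge nonneg; blast)
  then show "x \<in> V"
    by (auto simp: voronoi_cell_lattice)
qed

lemma voronoi_cell_relevant:
  "V = {x. \<forall>v \<in> comb ` relevant \<union> uminus ` comb ` relevant. v \<bullet> x \<le> v \<bullet> v / 2}"
proof (intro set_eqI)
  fix x
  have "(\<forall>v \<in> comb ` relevant \<union> uminus ` comb ` relevant. v \<bullet> x \<le> v \<bullet> v / 2)
      \<longleftrightarrow> (\<forall>m\<in>relevant. \<bar>comb m \<bullet> x\<bar> \<le> comb m \<bullet> comb m / 2)"
    unfolding ball_Un ball_simps inner_minus_left inner_minus_right minus_minus abs_le_iff by blast
  moreover have "\<dots> \<longleftrightarrow> x \<in> V"
    unfolding relevant_def ball_simps mem_voronoi_cell comb_inner_self comb_inner[of _ _ _ x] by simp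
  ultimately show "x \<in> V \<longleftrightarrow> x \<in> {x. \<forall>v \<in> comb ` relevant \<union> uminus ` comb ` relevant. v \<bullet> x \<le> v \<bullet> v / 2}"
    by blast
qed

section \<open>Areas of the fourteen facets\<close>

definition facet_prism_measure :: "real^3 \<Rightarrow> real" where
  "facet_prism_measure v = measure lebesgue (prism (v /\<^sub>R norm v) (tight_face V v))"

text \<open>The cell is centrally symmetric, so negation exchanges opposite facets.\<close>

lemma facet_prism_measure_uminus: "facet_prism_measure (- v) = facet_prism_measure v"
proof -
  have V: "- x \<in> V \<longleftrightarrow> x \<in> V" for x
    unfolding mem_voronoi_cell inner_minus_right
    by (simp only: minus_add_distrib[symmetric] abs_minus_cancel)
  have "x \<in> tight_face V (- v) \<longleftrightarrow> - x \<in> tight_face V v" for x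
    by (simp add: tight_face_def V)
  then have "tight_face V (- v) = uminus ` tight_face V v"
    by (simp add: set_eq_iff image_iff) (metis minus_minus)
  then have "prism ((- v) /\<^sub>R norm (- v)) (tight_face V (- v)) = uminus ` prism (v /\<^sub>R norm v) (tight_face V v)"
    by (simp add: prism_uminus)
  then show ?thesis
    by (simp only: facet_prism_measure_def measure_uminus_image)
qed

text \<open>As \<open>p\<close>, \<open>q\<close>, \<open>comb m\<close> have the same covolume as
  \<open>B\<close>, \<open>measure_prism_plane\<close> yields the factor
  \<open>norm (comb m) / \<bar>det B\<bar>\<close>.\<close>

lemma facet_prism_measure_slab:
  assumes det: "\<bar>det (vector [p, q, comb m] :: real^3^3)\<bar> = \<bar>det B\<bar>"
    and R: "slab R \<in> lmeasurable" "measure lebesgue (slab R) = A"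
    and s: "comb m \<bullet> comb m = s"
    and face: "\<And>x. comb m \<bullet> x = s / 2 \<Longrightarrow> x \<in> V \<longleftrightarrow> R (p \<bullet> x - u0) (q \<bullet> x - w0)"
  shows "facet_prism_measure (comb m) = sqrt s * A / \<bar>det B\<bar>"
proof -
  have "tight_face V (comb m) = {x. comb m \<bullet> x = s / 2 \<and> R (p \<bullet> x - u0) (q \<bullet> x - w0)}"
    unfolding tight_face_def s using face by blast
  moreover have "det (vector [p, q, comb m] :: real^3^3) \<noteq> 0"
    using det det_basis_nonzero by auto
  moreover have "norm (comb m) = sqrt s"
    by (simp add: norm_eq_sqrt_inner s)
  ultimately show ?thesis
    using measure_prism_plane[of p q "comb m" R "s / 2" u0 w0] R det
    by (simp add: facet_prism_measure_def)
qed

text \<open>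
  On the facet normal to \<open>b\<^sub>S\<close>, writing \<open>b\<^sub>i \<bullet> x\<close> as the net flow out of \<open>i\<close> with capacities
  \<open>\<rho>ij / 2\<close>, all edges leaving \<open>S\<close> are saturated. The offsets below are these saturated flows; what
  remains are flows inside \<open>S\<close> and inside its complement.
\<close>

lemma facet_prism_measure_relevant:
  shows "facet_prism_measure (comb (1,0,0)) = sqrt (a + d + e) * (b * c + b * f + c * f) / \<bar>det B\<bar>"
    and "facet_prism_measure (comb (0,1,0)) = sqrt (b + d + f) * (a * c + a * e + c * e) / \<bar>det B\<bar>"
    and "facet_prism_measure (comb (0,0,1)) = sqrt (c + e + f) * (a * b + a * d + b * d) / \<bar>det B\<bar>"
    and "facet_prism_measure (comb (1,1,1)) = sqrt (a + b + c) * (e * f + e * d + f * d) / \<bar>det B\<bar>"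
    and "facet_prism_measure (comb (1,1,0)) = sqrt (a + b + e + f) * (d * c) / \<bar>det B\<bar>"
    and "facet_prism_measure (comb (1,0,1)) = sqrt (a + c + d + f) * (e * b) / \<bar>det B\<bar>"
    and "facet_prism_measure (comb (0,1,1)) = sqrt (b + c + d + e) * (a * f) / \<bar>det B\<bar>"
proof -
  \<comment> \<open>Each triple is a basis of the same lattice: \<open>comb m\<close> contains the
    missing basis vector with coefficient one.\<close>
  have det: "\<bar>det (vector [B $ 2, B $ 3, comb (1,0,0)] :: real^3^3)\<bar> = \<bar>det B\<bar>"
    "\<bar>det (vector [B $ 1, B $ 3, comb (0,1,0)] :: real^3^3)\<bar> = \<bar>det B\<bar>"
    "\<bar>det (vector [B $ 1, B $ 2, comb (0,0,1)] :: real^3^3)\<bar> = \<bar>det B\<bar>"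
    "\<bar>det (vector [B $ 1, B $ 2, comb (1,1,1)] :: real^3^3)\<bar> = \<bar>det B\<bar>"
    "\<bar>det (vector [B $ 1, B $ 3, comb (1,1,0)] :: real^3^3)\<bar> = \<bar>det B\<bar>"
    "\<bar>det (vector [B $ 1, B $ 2, comb (1,0,1)] :: real^3^3)\<bar> = \<bar>det B\<bar>"
    "\<bar>det (vector [B $ 1, B $ 2, comb (0,1,1)] :: real^3^3)\<bar> = \<bar>det B\<bar>"
    unfolding det_3 comb_def abs_eq_iff by (simp_all add: vector_3 algebra_simps)
  show "facet_prism_measure (comb (1,0,0)) = sqrt (a + d + e) * (b * c + b * f + c * f) / \<bar>det B\<bar>"
  \<comment> \<open>The third parameter of \<open>slab_hexagon\<close> joins the two coordinate
    indices; the first two join them to the remaining index on the same side of the cut. The same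
    holds for the other hexagons.\<close>
  proof (rule facet_prism_measure_slab[OF det(1) slab_hexagon[OF nonneg(2,3,6)]])
    fix x assume "comb (1,0,0) \<bullet> x = (a + d + e) / 2"
    then have y: "B $ 1 \<bullet> x = (a + d + e) / 2"
      by (simp add: comb_inner field_simps)
    show "x \<in> V \<longleftrightarrow> \<bar>B $ 2 \<bullet> x - (- d / 2)\<bar> \<le> (b + f) / 2 \<and> \<bar>B $ 3 \<bullet> x - (- e / 2)\<bar> \<le> (c + f) / 2
      \<and> \<bar>B $ 2 \<bullet> x - (- d / 2) + (B $ 3 \<bullet> x - (- e / 2))\<bar> \<le> (b + c) / 2"
      unfolding mem_voronoi_cell y abs_le_iff using nonneg by argo
  qed (simp add: comb_inner_self)
  show "facet_prism_measure (comb (0,1,0)) = sqrt (b + d + f) * (a * c + a * e + c * e) / \<bar>det B\<bar>"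
  proof (rule facet_prism_measure_slab[OF det(2) slab_hexagon[OF nonneg(1,3,5)]])
    fix x assume "comb (0,1,0) \<bullet> x = (b + d + f) / 2"
    then have y: "B $ 2 \<bullet> x = (b + d + f) / 2"
      by (simp add: comb_inner field_simps)
    show "x \<in> V \<longleftrightarrow> \<bar>B $ 1 \<bullet> x - (- d / 2)\<bar> \<le> (a + e) / 2 \<and> \<bar>B $ 3 \<bullet> x - (- f / 2)\<bar> \<le> (c + e) / 2
      \<and> \<bar>B $ 1 \<bullet> x - (- d / 2) + (B $ 3 \<bullet> x - (- f / 2))\<bar> \<le> (a + c) / 2"
      unfolding mem_voronoi_cell y abs_le_iff using nonneg by argo
  qed (simp add: comb_inner_self)
  show "facet_prism_measure (comb (0,0,1)) = sqrt (c + e + f) * (a * b + a * d + b * d) / \<bar>det B\<bar>"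
  proof (rule facet_prism_measure_slab[OF det(3) slab_hexagon[OF nonneg(1,2,4)]])
    fix x assume "comb (0,0,1) \<bullet> x = (c + e + f) / 2"
    then have y: "B $ 3 \<bullet> x = (c + e + f) / 2"
      by (simp add: comb_inner field_simps)
    show "x \<in> V \<longleftrightarrow> \<bar>B $ 1 \<bullet> x - (- e / 2)\<bar> \<le> (a + d) / 2 \<and> \<bar>B $ 2 \<bullet> x - (- f / 2)\<bar> \<le> (b + d) / 2
      \<and> \<bar>B $ 1 \<bullet> x - (- e / 2) + (B $ 2 \<bullet> x - (- f / 2))\<bar> \<le> (a + b) / 2"
      unfolding mem_voronoi_cell y abs_le_iff using nonneg by argo
  qed (simp add: comb_inner_self)
  show "facet_prism_measure (comb (1,1,1)) = sqrt (a + b + c) * (e * f + e * d + f * d) / \<bar>det B\<bar>"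
  proof (rule facet_prism_measure_slab[OF det(4) slab_hexagon[OF nonneg(5,6,4)]])
    fix x assume "comb (1,1,1) \<bullet> x = (a + b + c) / 2"
    then have y: "B $ 3 \<bullet> x = (a + b + c) / 2 - B $ 1 \<bullet> x - B $ 2 \<bullet> x"
      by (simp add: comb_inner field_simps)
    show "x \<in> V \<longleftrightarrow> \<bar>B $ 1 \<bullet> x - (a / 2)\<bar> \<le> (e + d) / 2 \<and> \<bar>B $ 2 \<bullet> x - (b / 2)\<bar> \<le> (f + d) / 2
      \<and> \<bar>B $ 1 \<bullet> x - (a / 2) + (B $ 2 \<bullet> x - (b / 2))\<bar> \<le> (e + f) / 2"
      unfolding mem_voronoi_cell y abs_le_iff using nonneg by argo
  qed (simp add: comb_inner_self)
  show "facet_prism_measure (comb (1,1,0)) = sqrt (a + b + e + f) * (d * c) / \<bar>det B\<bar>"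
  \<comment> \<open>For a two-element set one edge lies inside it and one inside its complement, so
    the two coordinates vary independently and the facet is a rectangle.\<close>
  proof (rule facet_prism_measure_slab[OF det(5) slab_rectangle[OF nonneg(4,3)]])
    fix x assume "comb (1,1,0) \<bullet> x = (a + b + e + f) / 2"
    then have y: "B $ 2 \<bullet> x = (a + b + e + f) / 2 - B $ 1 \<bullet> x"
      by (simp add: comb_inner field_simps)
    show "x \<in> V \<longleftrightarrow> \<bar>B $ 1 \<bullet> x - ((a + e) / 2)\<bar> \<le> d / 2 \<and> \<bar>B $ 3 \<bullet> x - (- (e + f) / 2)\<bar> \<le> c / 2"
      unfolding mem_voronoi_cell y abs_le_iff using nonneg by argo
  qed (simp add: comb_inner_self)
  show "facet_prism_measure (comb (1,0,1)) = sqrt (a + c + d + f) * (e * b) / \<bar>det B\<bar>"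
  proof (rule facet_prism_measure_slab[OF det(6) slab_rectangle[OF nonneg(5,2)]])
    fix x assume "comb (1,0,1) \<bullet> x = (a + c + d + f) / 2"
    then have y: "B $ 3 \<bullet> x = (a + c + d + f) / 2 - B $ 1 \<bullet> x"
      by (simp add: comb_inner field_simps)
    show "x \<in> V \<longleftrightarrow> \<bar>B $ 1 \<bullet> x - ((a + d) / 2)\<bar> \<le> e / 2 \<and> \<bar>B $ 2 \<bullet> x - (- (d + f) / 2)\<bar> \<le> b / 2"
      unfolding mem_voronoi_cell y abs_le_iff using nonneg by argo
  qed (simp add: comb_inner_self)
  show "facet_prism_measure (comb (0,1,1)) = sqrt (b + c + d + e) * (a * f) / \<bar>det B\<bar>"
  proof (rule facet_prism_measure_slab[OF det(7) slab_rectangle[OF nonneg(1,6)]])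
    fix x assume "comb (0,1,1) \<bullet> x = (b + c + d + e) / 2"
    then have y: "B $ 3 \<bullet> x = (b + c + d + e) / 2 - B $ 2 \<bullet> x"
      by (simp add: comb_inner field_simps)
    show "x \<in> V \<longleftrightarrow> \<bar>B $ 1 \<bullet> x - (- (d + e) / 2)\<bar> \<le> a / 2 \<and> \<bar>B $ 2 \<bullet> x - ((b + d) / 2)\<bar> \<le> f / 2"
      unfolding mem_voronoi_cell y abs_le_iff using nonneg by argo
  qed (simp add: comb_inner_self)
qed

lemma surface_area_voronoi_cell:
  "surface_area V = 2 * voronoi_area_form (a, b, c, d, e, f) / sqrt (det (selling_matrix (a, b, c, d, e, f)))"
proof -
  let ?N = "comb ` relevant"
  have fin: "finite ?N" "finite (uminus ` ?N)"
    by (simp_all add: relevant_def)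
  have disj: "?N \<inter> uminus ` ?N = {}"
  proof (rule ccontr)
    assume "?N \<inter> uminus ` ?N \<noteq> {}"
    then obtain m i j k where m: "m \<in> relevant" "(i, j, k) \<in> relevant" "comb m = - comb (i, j, k)"
      by auto
    then have "m = (- i, - j, - k)"
      by (metis comb_uminus inj_comb injD)
    with m show False
      by (auto simp: relevant_def)
  qed
  have "comb (0, 0, 0) = 0"
    by (simp add: comb_def)
  moreover have "(0, 0, 0) \<notin> relevant"
    by (simp add: relevant_def)
  ultimately have "0 \<notin> ?N"
    by (metis imageE inj_comb injD)
  then have "0 \<notin> ?N \<union> uminus ` ?N"
    by force
  then have "surface_area V = sum facet_prism_measure (?N \<union> uminus ` ?N)"
    unfolding facet_prism_measure_def
    by (intro surface_area_tight_faces voronoi_cell_relevant) (use fin in auto)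
  also have "\<dots> = sum facet_prism_measure ?N + sum facet_prism_measure (uminus ` ?N)"
    using fin disj by (rule sum.union_disjoint)
  also have "sum facet_prism_measure (uminus ` ?N) = sum facet_prism_measure ?N"
    by (subst sum.reindex) (auto simp: facet_prism_measure_uminus)
  also have "sum facet_prism_measure ?N = (\<Sum>m\<in>relevant. facet_prism_measure (comb m))"
    by (subst sum.reindex) (auto intro: inj_on_subset[OF inj_comb])
  also have "\<dots> = voronoi_area_form (a, b, c, d, e, f) / \<bar>det B\<bar>"
    unfolding relevant_def
    by (simp add: facet_prism_measure_relevant voronoi_area_form_def add_divide_distrib algebra_simps)
  finally show ?thesis
    by (simp add: abs_det_basis)
qed

end

section \<open>The explicit isoperimetric quotient\<close>

text \<open>Cholesky factorisation: the squares of \<open>r\<close> and \<open>u\<close> are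
  quotients of successive leading minors, so the sign conditions justify the square roots.\<close>

lemma cholesky_3:
  fixes A11 A12 A13 A22 A23 A33 :: real
  assumes pos: "A11 > 0" "A11 * A22 - A12\<^sup>2 > 0"
    and det: "A11 * A22 * A33 + 2 * A12 * A13 * A23 - A11 * A23\<^sup>2 - A22 * A13\<^sup>2 - A33 * A12\<^sup>2 \<ge> 0"
  obtains p q r s t u :: real
  where "p * p = A11" "p * q = A12" "p * s = A13" "q * q + r * r = A22" "q * s + r * t = A23"
    "s * s + t * t + u * u = A33"
proof -
  define p where "p = sqrt A11"
  define q where "q = A12 / p"
  define s where "s = A13 / p"
  define r where "r = sqrt (A22 - q\<^sup>2)"
  define t where "t = (A23 - q * s) / r"
  define u where "u = sqrt (A33 - s\<^sup>2 - t\<^sup>2)"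
  have p: "p > 0" "p\<^sup>2 = A11"
    using pos by (simp_all add: p_def)
  have pq: "p * q = A12" "p * s = A13"
    using p by (simp_all add: q_def s_def)
  have "p\<^sup>2 * (A22 - q\<^sup>2) = A11 * A22 - A12\<^sup>2"
    by (simp add: p(2) pq(1)[symmetric] power_mult_distrib right_diff_distrib)
  then have r2: "A22 - q\<^sup>2 > 0"
    using p pos by (metis zero_less_mult_pos zero_less_power)
  then have r: "r > 0" "r\<^sup>2 = A22 - q\<^sup>2"
    by (simp_all add: r_def)
  have rt: "r * t = A23 - q * s"
    using r by (simp add: t_def)
  have "p\<^sup>2 * r\<^sup>2 * (A33 - s\<^sup>2 - t\<^sup>2) = p\<^sup>2 * r\<^sup>2 * A33 - r\<^sup>2 * (p * s)\<^sup>2 - p\<^sup>2 * (r * t)\<^sup>2"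
    by (simp add: algebra_simps power_mult_distrib)
  also have "\<dots> = p\<^sup>2 * (A22 - q\<^sup>2) * A33 - (A22 - q\<^sup>2) * (p * s)\<^sup>2 - p\<^sup>2 * (A23 - q * s)\<^sup>2"
    by (simp only: r(2) rt)
  also have "\<dots> = p\<^sup>2 * A22 * A33 + 2 * (p * q) * (p * s) * A23 - p\<^sup>2 * A23\<^sup>2 - A22 * (p * s)\<^sup>2 - A33 * (p * q)\<^sup>2"
    by (simp add: algebra_simps power2_eq_square)
  also have "\<dots> \<ge> 0"
    using det by (simp add: p(2) pq)
  finally have "A33 - s\<^sup>2 - t\<^sup>2 \<ge> 0"
    using p r by (metis mult_pos_pos zero_le_mult_iff zero_less_power less_le_not_le)
  then have "u\<^sup>2 = A33 - s\<^sup>2 - t\<^sup>2"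
    by (simp add: u_def)
  with that[of p q s r t u] p pq r rt show thesis
    by (simp add: power2_eq_square algebra_simps)
qed

text \<open>The monomials are the sixteen spanning trees of the complete graph on 0, 1, 2, 3
  (matrix-tree theorem): all triples of edges except the four triangles.\<close>

lemma det_selling_matrix:
  "det (selling_matrix (a, b, c, d, e, f)) =
    a * b * c + a * b * e + a * b * f + a * c * d + a * c * f + a * d * e + a * d * f + a * e * f
    + b * c * d + b * c * e + b * d * e + b * d * f + b * e * f + c * d * e + c * d * f + c * e * f"
  by (simp add: det_3 vector_3 algebra_simps)

lemma ex_selling_basis:
  assumes "(a, b, c, d, e, f) \<in> selling_domain"
  shows "\<exists>B. has_selling_parameters B (a, b, c, d, e, f)"
proof -
  have nonneg: "a \<ge> 0" "b \<ge> 0" "c \<ge> 0" "d \<ge> 0" "e \<ge> 0" "f \<ge> 0"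
    and det: "det (selling_matrix (a, b, c, d, e, f)) > 0"
    using assms by (simp_all add: selling_domain_def selling_orthant_def)
  define m where "m = (a + d + e) * (b + d + f) - (- d)\<^sup>2"
  have m: "m = a * b + a * d + a * f + d * b + d * f + e * b + e * d + e * f"
    by (simp add: m_def algebra_simps power2_eq_square)
  \<comment> \<open>Positivity passes down to the smaller leading minors: the second minor
    \<open>m\<close> bounds the determinant up to the factor \<open>a + b + c + d + e + f\<close>,
    and the product of two diagonal entries bounds \<open>m\<close>.\<close>
  have "det (selling_matrix (a, b, c, d, e, f)) \<le> (a + b + c + d + e + f) * m"
  proof -
    have "0 \<le> (a + b + c + d + e + f) * m - det (selling_matrix (a, b, c, d, e, f))"
      unfolding det_selling_matrix m using nonneg by (simp add: algebra_simps)
    then show ?thesis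
      by simp
  qed
  then have "(a + b + c + d + e + f) * m > 0"
    using det by simp
  then have "m > 0"
    using nonneg by (simp add: zero_less_mult_iff)
  have "m \<le> (a + d + e) * (b + d + f)"
    by (simp add: m_def)
  then have "(a + d + e) * (b + d + f) > 0"
    using \<open>m > 0\<close> by simp
  then have "a + d + e > 0"
    using nonneg by (simp add: zero_less_mult_iff)
  then obtain p q r s t u :: real where *: "p * p = a + d + e" "p * q = - d" "p * s = - e"
    "q * q + r * r = b + d + f" "q * s + r * t = - f" "s * s + t * t + u * u = c + e + f"
  proof (rule cholesky_3)
    show "0 < (a + d + e) * (b + d + f) - (- d)\<^sup>2"
      using \<open>m > 0\<close> by (simp add: m_def)
    show "0 \<le> (a + d + e) * (b + d + f) * (c + e + f) + 2 * (- d) * (- e) * (- f)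
      - (a + d + e) * (- f)\<^sup>2 - (b + d + f) * (- e)\<^sup>2 - (c + e + f) * (- d)\<^sup>2"
      using det by (simp add: det_3 vector_3 power2_eq_square algebra_simps)
  qed
  then have "has_selling_parameters (vector [vector [p, 0, 0], vector [q, r, 0], vector [s, t, u]])
      (a, b, c, d, e, f)"
    by (simp add: has_selling_parameters_def forall_3 vector_3 inner_3 mult.commute)
  then show ?thesis
    by blast
qed

text \<open>The unspecified basis enters only through its Gram matrix. The exponent is
  \<open>1/2 + 1/3\<close>, from the covolume and the normalisation.\<close>

lemma iso_quotient_eq:
  assumes "\<rho> \<in> selling_domain"
  shows "iso_quotient \<rho> = 2 * voronoi_area_form \<rho> / det (selling_matrix \<rho>) powr (5 / 6)"
proof -
  obtain a b c d e f where \<rho>: "\<rho> = (a, b, c, d, e, f)"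
    by (cases \<rho>) auto
  define B where "B = (SOME B. has_selling_parameters B \<rho>)"
  define D where "D = det (selling_matrix \<rho>)"
  have "D > 0"
    using assms by (simp add: selling_domain_def D_def)
  have "has_selling_parameters B \<rho>"
    unfolding B_def using ex_selling_basis assms by (auto simp: \<rho> intro: someI_ex)
  then interpret selling_basis B a b c d e f
    by unfold_locales (use assms in \<open>auto simp: \<rho> selling_domain_def selling_orthant_def\<close>)
  have "surface_area (voronoi_cell (lattice_of B)) = 2 * voronoi_area_form \<rho> / sqrt D"
    using surface_area_voronoi_cell by (simp only: D_def \<rho>)
  then have "iso_quotient \<rho> = 2 * voronoi_area_form \<rho> / sqrt D / D powr (1 / 3)"
    by (simp only: iso_quotient_def selling_lattice_def B_def[symmetric] D_def)
  also have "\<dots> = 2 * voronoi_area_form \<rho> / (D powr (1 / 2) * D powr (1 / 3))"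
    using \<open>D > 0\<close> by (simp add: powr_half_sqrt)
  also have "D powr (1 / 2) * D powr (1 / 3) = D powr (5 / 6)"
    by (simp flip: powr_add)
  finally show ?thesis
    by (simp add: D_def)
qed

text \<open>\<open>b\<close>, \<open>c\<close>, \<open>d\<close> are the edges of a spanning tree,
  so \<open>b * c * d\<close> is one of the nonnegative monomials of the determinant.\<close>

lemma selling_domainI:
  assumes "a \<ge> 0" "b > 0" "c > 0" "d > 0" "e > 0" "f \<ge> 0"
  shows "(a, b, c, d, e, f) \<in> selling_domain"
proof -
  have "det (selling_matrix (a, b, c, d, e, f)) \<ge> b * c * d"
    unfolding det_selling_matrix using assms by (simp add: algebra_simps)
  moreover have "b * c * d > 0"
    using assms by simp
  ultimately have "det (selling_matrix (a, b, c, d, e, f)) > 0"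
    by linarith
  then show ?thesis
    using assms by (simp add: selling_domain_def selling_orthant_def)
qed

section \<open>Estimates near the FCC point\<close>

text \<open>Compared with the Taylor coefficient \<open>1/8\<close>, the choice \<open>1/7\<close>
  leaves a surplus \<open>1/28\<close> after squaring; this absorbs the higher terms even at
  \<open>\<epsilon> = - 1/5\<close>.\<close>

lemma sqrt_ge_quadratic:
  fixes \<epsilon> :: real
  assumes "\<bar>\<epsilon>\<bar> \<le> 1 / 5"
  shows "1 + \<epsilon> / 2 - \<epsilon>\<^sup>2 / 7 \<le> sqrt (1 + \<epsilon>)"
proof (rule real_le_rsqrt)
  have "\<epsilon>\<^sup>2 \<le> (1 / 5)\<^sup>2"
    using assms by (metis abs_ge_zero power2_abs power_mono)
  then have "0 \<le> 1 / 28 + \<epsilon> / 7 - \<epsilon>\<^sup>2 / 49"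
    using assms by (simp add: power2_eq_square)
  then have "0 \<le> \<epsilon>\<^sup>2 * (1 / 28 + \<epsilon> / 7 - \<epsilon>\<^sup>2 / 49)"
    by simp
  also have "\<dots> = 1 + \<epsilon> - (1 + \<epsilon> / 2 - \<epsilon>\<^sup>2 / 7)\<^sup>2"
    by (simp add: power2_eq_square field_simps)
  finally show "(1 + \<epsilon> / 2 - \<epsilon>\<^sup>2 / 7)\<^sup>2 \<le> 1 + \<epsilon>"
    by simp
qed

text \<open>With \<open>s = x + y\<close> and \<open>t = x * y\<close> the radicand is
  \<open>1 + 3/2 s + s^2/2 + t + s t/2\<close>. In \<open>sqrt_ge_quadratic\<close> the coefficient
  of \<open>s^2\<close> becomes \<open>1/4 - 9/28 = - 1/14\<close>; all terms of higher order fit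
  into \<open>(x^2 + y^2) / 100\<close>.\<close>

lemma sqrt_pair_ge:
  fixes x y :: real
  assumes "\<bar>x\<bar> \<le> 1 / 200" "\<bar>y\<bar> \<le> 1 / 200"
  shows "1 + 3 / 4 * (x + y) - (x + y)\<^sup>2 / 14 + x * y / 2 - (x\<^sup>2 + y\<^sup>2) / 100
    \<le> sqrt ((1 + x) * (1 + y) * (1 + (x + y) / 2))"
proof -
  define s t u where "s = x + y" and "t = x * y" and "u = x\<^sup>2 + y\<^sup>2"
  define r where "r = s\<^sup>2 / 2 + t + s * t / 2"
  define \<epsilon> where "\<epsilon> = 3 / 2 * s + r"
  have u0: "u \<ge> 0"
    by (simp add: u_def)
  have s: "\<bar>s\<bar> \<le> 1 / 100"
    using assms unfolding s_def by argo
  have "x\<^sup>2 \<le> (1 / 200)\<^sup>2" "y\<^sup>2 \<le> (1 / 200)\<^sup>2"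
    using assms by (metis abs_ge_zero power2_abs power_mono)+
  then have u1: "u \<le> 1 / 20000"
    by (simp add: u_def power2_eq_square)
  have "0 \<le> (x - y)\<^sup>2" "0 \<le> (x + y)\<^sup>2"
    by simp_all
  then have t: "\<bar>t\<bar> \<le> u / 2" and s2: "s\<^sup>2 \<le> 2 * u"
    by (simp_all add: s_def t_def u_def power2_eq_square algebra_simps abs_le_iff)
  have "\<bar>s * t\<bar> \<le> 1 / 100 * (u / 2)"
    unfolding abs_mult using s t by (intro mult_mono) auto
  then have st: "\<bar>s * t\<bar> \<le> u / 200"
    by simp
  have r: "\<bar>r\<bar> \<le> 2 * u"
    using t s2 st u0 zero_le_power2[of s] unfolding r_def by argo
  have "\<bar>s * r\<bar> \<le> 1 / 100 * (2 * u)"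
    unfolding abs_mult using s r by (intro mult_mono) auto
  then have sr: "\<bar>s * r\<bar> \<le> u / 50"
    by simp
  have "\<bar>r * r\<bar> \<le> 1 / 10000 * (2 * u)"
    unfolding abs_mult using r u1 by (intro mult_mono) auto
  then have rr: "r\<^sup>2 \<le> u / 5000"
    by (simp add: power2_eq_square)
  have "\<epsilon>\<^sup>2 = 9 / 4 * s\<^sup>2 + 3 * (s * r) + r\<^sup>2"
    by (simp add: \<epsilon>_def power2_eq_square algebra_simps)
  then have \<epsilon>2: "\<epsilon>\<^sup>2 \<le> 9 / 4 * s\<^sup>2 + 3 * (u / 50) + u / 5000"
    using sr rr by linarith
  have \<epsilon>1: "\<epsilon> / 2 \<ge> 3 / 4 * s + s\<^sup>2 / 4 + t / 2 - u / 800"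
    using st unfolding \<epsilon>_def r_def by (simp add: field_simps abs_le_iff)
  have "1 + 3 / 4 * s - s\<^sup>2 / 14 + t / 2 - u / 100 \<le> 1 + \<epsilon> / 2 - \<epsilon>\<^sup>2 / 7"
    using \<epsilon>1 \<epsilon>2 u0 by linarith
  also have "\<dots> \<le> sqrt (1 + \<epsilon>)"
  proof (rule sqrt_ge_quadratic)
    show "\<bar>\<epsilon>\<bar> \<le> 1 / 5"
      using s r u1 unfolding \<epsilon>_def by argo
  qed
  also have "1 + \<epsilon> = (1 + x) * (1 + y) * (1 + (x + y) / 2)"
    by (simp add: \<epsilon>_def r_def s_def t_def power2_eq_square field_simps)
  finally show ?thesis
    by (simp add: s_def t_def u_def)
qed

text \<open>
  With \<open>q\<close> the sum of the squares, the right-hand side is \<open>1 - 5/16 q\<close> and the left-hand side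
  \<open>1 - 1/2 q\<close> up to third order. This leaves room for the weaker coefficient \<open>1/7\<close> (in place of
  \<open>1/8\<close>) in the bound for the square root.
\<close>

lemma sum_sqrt_pairs_gt:
  fixes x y z w :: real
  defines "\<phi> \<equiv> \<lambda>x y :: real. sqrt ((1 + x) * (1 + y) * (1 + (x + y) / 2))"
  assumes small: "\<bar>x\<bar> \<le> 1 / 200" "\<bar>y\<bar> \<le> 1 / 200" "\<bar>z\<bar> \<le> 1 / 200" "\<bar>w\<bar> \<le> 1 / 200"
    and sum: "x + y + z + w = 0" and ne: "\<not> (x = 0 \<and> y = 0 \<and> z = 0 \<and> w = 0)"
  shows "(1 + x) * (1 + y) * (1 + z) * (1 + w)
    < ((\<phi> x y + \<phi> x z + \<phi> x w + \<phi> y z + \<phi> y w + \<phi> z w) / 6) ^ 6"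
proof -
  define q where "q = x\<^sup>2 + y\<^sup>2 + z\<^sup>2 + w\<^sup>2"
  define S where "S = \<phi> x y + \<phi> x z + \<phi> x w + \<phi> y z + \<phi> y w + \<phi> z w"
  have "q > 0"
    using ne by (auto simp: q_def add_nonneg_eq_0_iff less_le)
  define l where "l x y = 1 + 3 / 4 * (x + y) - (x + y)\<^sup>2 / 14 + x * y / 2 - (x\<^sup>2 + y\<^sup>2) / 100" for x y :: real
  have "S \<ge> l x y + l x z + l x w + l y z + l y w + l z w"
    unfolding S_def \<phi>_def l_def using small by (intro add_mono sqrt_pair_ge)
  \<comment> \<open>Over the six pairs, the squares of the sums add up to \<open>2 q\<close> plus
    the square of the total, the products to half of that square minus \<open>q\<close>, and each
    single square occurs three times.\<close>
  also have "l x y + l x z + l x w + l y z + l y w + l z w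
    = 6 + 9 / 4 * (x + y + z + w) - (2 * q + (x + y + z + w)\<^sup>2) / 14
      + ((x + y + z + w)\<^sup>2 - q) / 4 - 3 * q / 100"
    by (simp add: l_def q_def power2_eq_square field_simps)
  also have "\<dots> = 6 - (1 / 7 + 1 / 4 + 3 / 100) * q"
    unfolding sum by (simp add: field_simps)
  finally have S: "S \<ge> 6 - (1 / 7 + 1 / 4 + 3 / 100) * q" .
  have e3: "u * v * k \<le> q / 400" if "\<bar>u\<bar> \<le> 1 / 200" "v\<^sup>2 + k\<^sup>2 \<le> q" for u v k
  proof -
    have "0 \<le> (\<bar>v\<bar> - \<bar>k\<bar>)\<^sup>2"
      by simp
    then have "\<bar>v * k\<bar> \<le> q / 2"
      using that(2) by (simp add: power2_eq_square algebra_simps abs_mult)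
    then have "\<bar>u\<bar> * \<bar>v * k\<bar> \<le> 1 / 200 * (q / 2)"
      using that(1) by (intro mult_mono) auto
    moreover have "u * v * k \<le> \<bar>u\<bar> * \<bar>v * k\<bar>"
      by (metis abs_ge_self abs_mult mult.assoc)
    ultimately show ?thesis
      by simp
  qed
  have sq: "x\<^sup>2 \<ge> 0" "y\<^sup>2 \<ge> 0" "z\<^sup>2 \<ge> 0" "w\<^sup>2 \<ge> 0"
    by simp_all
  have e4: "\<bar>x * y\<bar> \<le> 1 / 200"
    using mult_mono[OF small(1,2)] by (simp add: abs_mult)
  have "(1 + x) * (1 + y) * (1 + z) * (1 + w)
    = 1 + (x + y + z + w) + ((x + y + z + w)\<^sup>2 - q) / 2
      + (x * y * z + x * y * w + x * z * w + y * z * w) + (x * y) * z * w"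
    by (simp add: q_def power2_eq_square field_simps)
  also have "\<dots> \<le> 1 - q / 2 + (q / 400 + q / 400 + q / 400 + q / 400) + q / 400"
    unfolding sum using small sq e4
    by (intro add_mono e3) (simp_all add: q_def add_divide_distrib)
  \<comment> \<open>The coefficients of \<open>- q\<close> are 0.4875 on the left and about 0.423 on
    the right.\<close>
  also have "\<dots> < 6 - (1 / 7 + 1 / 4 + 3 / 100) * q - 5"
    using \<open>q > 0\<close> by simp
  also have "\<dots> \<le> 1 + 6 * (S / 6 - 1)"
    using S by simp
  \<comment> \<open>Bernoulli requires \<open>S / 6 - 1 \<ge> - 1\<close>, hence the check that
    \<open>S\<close> is nonnegative.\<close>
  also have "\<dots> \<le> (S / 6) ^ 6"
  proof -
    have "\<phi> u v \<ge> 0" if "\<bar>u\<bar> \<le> 1 / 200" "\<bar>v\<bar> \<le> 1 / 200" for u v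
      using that unfolding \<phi>_def by (intro real_sqrt_ge_zero mult_nonneg_nonneg; argo)
    then have "S \<ge> 0"
      unfolding S_def using small by (intro add_nonneg_nonneg)
    then show ?thesis
      using Bernoulli_inequality[of "S / 6 - 1" 6] by simp
  qed
  finally show ?thesis
    by (simp add: S_def)
qed

text \<open>Here \<open>1 + x\<close> and \<open>1 + y\<close> are the inverses of \<open>b\<close>
  and \<open>c\<close> divided by \<open>L\<close>, and
  \<open>b + c = (b c)^2 * (1/b) * (1/c) * (1/b + 1/c)\<close>. The prefactor \<open>b * c\<close>
  completes the product of the other two parameters in the area form to
  \<open>b * c * d * e\<close>.\<close>

lemma sqrt_add_eq_dual:
  fixes b c L :: real
  assumes pos: "b > 0" "c > 0" "L > 0"
  defines "x \<equiv> 1 / (b * L) - 1" and "y \<equiv> 1 / (c * L) - 1"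
  shows "sqrt (b + c) = b * c * (sqrt 2 * sqrt (L ^ 3) * sqrt ((1 + x) * (1 + y) * (1 + (x + y) / 2)))"
proof -
  have "b + c = (b * c)\<^sup>2 * (2 * L ^ 3 * ((1 + x) * (1 + y) * (1 + (x + y) / 2)))"
    using pos by (simp add: x_def y_def field_simps power2_eq_square power3_eq_cube)
  then have "sqrt (b + c) = sqrt ((b * c)\<^sup>2 * (2 * L ^ 3 * ((1 + x) * (1 + y) * (1 + (x + y) / 2))))"
    by (rule arg_cong)
  also have "\<dots> = b * c * (sqrt 2 * sqrt (L ^ 3) * sqrt ((1 + x) * (1 + y) * (1 + (x + y) / 2)))"
    using pos by (simp add: real_sqrt_mult)
  finally show ?thesis .
qed

text \<open>\<open>L\<close> is the mean of the inverses and \<open>g\<close> the relative deviation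
  from it, so the deviations sum to zero. The determinant condition reads \<open>P * L = 1\<close>;
  by \<open>sqrt_add_eq_dual\<close> the area form is then \<open>sqrt 2 * sqrt L * S\<close>, and
  \<open>sum_sqrt_pairs_gt\<close> bounds the sixth power of \<open>sqrt L * S / 6\<close> below by
  1.\<close>

lemma area_form_RD_gt:
  fixes b c d e :: real
  assumes near: "\<bar>b - 1\<bar> \<le> 1 / 1000" "\<bar>c - 1\<bar> \<le> 1 / 1000" "\<bar>d - 1\<bar> \<le> 1 / 1000" "\<bar>e - 1\<bar> \<le> 1 / 1000"
    and det: "b * c * d + b * c * e + b * d * e + c * d * e = 4"
    and ne: "\<not> (b = 1 \<and> c = 1 \<and> d = 1 \<and> e = 1)"
  shows "6 * sqrt 2 < b * e * sqrt (c + d) + c * d * sqrt (b + e) + d * e * sqrt (b + c)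
    + b * c * sqrt (d + e) + c * e * sqrt (b + d) + b * d * sqrt (c + e)"
proof -
  define L where "L = (1 / b + 1 / c + 1 / d + 1 / e) / 4"
  define P where "P = b * c * d * e"
  define g where "g v = 1 / (v * L) - 1" for v
  have bds: "v \<ge> 999 / 1000" "v \<le> 1001 / 1000" "v > 0" if "\<bar>v - 1\<bar> \<le> 1 / 1000" for v :: real
    using that by argo+
  note pos = near[THEN bds(3)]
  have inv: "1 / v \<ge> 1000 / 1001" "1 / v \<le> 1000 / 999" if "\<bar>v - 1\<bar> \<le> 1 / 1000" for v :: real
    using bds[OF that] by (simp_all add: field_simps)
  have L: "L \<ge> 1000 / 1001" "L \<le> 1000 / 999"
    using inv[OF near(1)] inv[OF near(2)] inv[OF near(3)] inv[OF near(4)] unfolding L_def by argo+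
  then have "L > 0" by simp
  \<comment> \<open>The radius \<open>1/1000\<close> keeps \<open>v * L\<close> between 999/1001 and
    1001/999, well within what the bound \<open>1/200\<close> of \<open>sum_sqrt_pairs_gt\<close>
    allows.\<close>
  have small: "\<bar>g v\<bar> \<le> 1 / 200" if "\<bar>v - 1\<bar> \<le> 1 / 1000" for v
  proof -
    have "v * L \<ge> 999 / 1000 * (1000 / 1001)" "v * L \<le> 1001 / 1000 * (1000 / 999)"
      using bds[OF that] L by (intro mult_mono; simp)+
    moreover have "v * L > 0"
      using bds(3)[OF that] \<open>L > 0\<close> by simp
    ultimately have "1 / (v * L) \<le> 201 / 200" "199 / 200 \<le> 1 / (v * L)"
      by (simp_all add: divide_le_eq le_divide_eq)
    then show ?thesis
      unfolding g_def by argo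
  qed
  have PL: "P * L = 1"
    using det pos by (simp add: P_def L_def field_simps)
  have sum: "g b + g c + g d + g e = 0"
  proof -
    have "g b + g c + g d + g e = (1 / b + 1 / c + 1 / d + 1 / e) / L - 4"
      using \<open>L > 0\<close> by (simp add: g_def add_divide_distrib)
    also have "1 / b + 1 / c + 1 / d + 1 / e = 4 * L"
      by (simp add: L_def)
    finally show ?thesis
      using \<open>L > 0\<close> by simp
  qed
  have prod: "L ^ 3 * ((1 + g b) * (1 + g c) * (1 + g d) * (1 + g e)) = 1"
  proof -
    have "L ^ 3 * ((1 + g b) * (1 + g c) * (1 + g d) * (1 + g e)) = 1 / (P * L)"
      using pos \<open>L > 0\<close> by (simp add: g_def P_def power3_eq_cube)
    then show ?thesis
      by (simp add: PL)
  qed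
  \<comment> \<open>Vanishing deviations make all four parameters equal to \<open>1 / L\<close>, and
    \<open>prod\<close> then forces \<open>L = 1\<close>.\<close>
  have "\<not> (g b = 0 \<and> g c = 0 \<and> g d = 0 \<and> g e = 0)"
  proof
    assume g: "g b = 0 \<and> g c = 0 \<and> g d = 0 \<and> g e = 0"
    then have "L ^ 3 = 1"
      using prod by simp
    then have "L = 1"
      using \<open>L > 0\<close> power_eq_iff_eq_base[of 3 L 1] by simp
    with g pos ne show False
      by (simp add: g_def)
  qed
  define \<phi> where "\<phi> = (\<lambda>x y :: real. sqrt ((1 + x) * (1 + y) * (1 + (x + y) / 2)))"
  define S where "S = \<phi> (g b) (g c) + \<phi> (g b) (g d) + \<phi> (g b) (g e) + \<phi> (g c) (g d) + \<phi> (g c) (g e) + \<phi> (g d) (g e)"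
  have "(1 + g b) * (1 + g c) * (1 + g d) * (1 + g e) < (S / 6) ^ 6"
    unfolding S_def \<phi>_def using near[THEN small] sum
      \<open>\<not> (g b = 0 \<and> g c = 0 \<and> g d = 0 \<and> g e = 0)\<close>
    by (rule sum_sqrt_pairs_gt)
  then have "1 < L ^ 3 * (S / 6) ^ 6"
    using \<open>L > 0\<close> by (subst prod[symmetric]) simp
  also have "L ^ 3 = sqrt L ^ 6"
    using \<open>L > 0\<close> power_mult[of "sqrt L" 2 3] by simp
  also have "sqrt L ^ 6 * (S / 6) ^ 6 = (sqrt L * (S / 6)) ^ 6"
    by (rule power_mult_distrib[symmetric])
  finally have "1 < (sqrt L * (S / 6)) ^ 6" .
  moreover have "0 \<le> sqrt L * (S / 6)"
  proof -
    have "\<phi> (g u) (g v) \<ge> 0" if "\<bar>u - 1\<bar> \<le> 1 / 1000" "\<bar>v - 1\<bar> \<le> 1 / 1000" for u v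
      using small[OF that(1)] small[OF that(2)] unfolding \<phi>_def
      by (intro real_sqrt_ge_zero mult_nonneg_nonneg; argo)
    then show ?thesis
      unfolding S_def using near \<open>L > 0\<close> by (intro mult_nonneg_nonneg divide_nonneg_pos add_nonneg_nonneg) auto
  qed
  ultimately have "1 < sqrt L * (S / 6)"
    by (metis linorder_not_less power_le_one)
  then have "6 * sqrt 2 < sqrt 2 * sqrt L * S"
    by simp
  also have "sqrt L = P * sqrt (L ^ 3)"
  proof -
    have "sqrt (L ^ 3) = L * sqrt L"
      using \<open>L > 0\<close> by (simp add: power3_eq_cube real_sqrt_mult)
    then show ?thesis
      using PL by simp
  qed
  also have "sqrt 2 * (P * sqrt (L ^ 3)) * S = b * e * sqrt (c + d) + c * d * sqrt (b + e) + d * e * sqrt (b + c)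
    + b * c * sqrt (d + e) + c * e * sqrt (b + d) + b * d * sqrt (c + e)"
  proof -
    have *: "sqrt (u + v) = u * v * (sqrt 2 * sqrt (L ^ 3) * \<phi> (g u) (g v))" if "u > 0" "v > 0" for u v
      unfolding \<phi>_def g_def using that \<open>L > 0\<close> by (rule sqrt_add_eq_dual)
    show ?thesis
      using pos by (simp add: * S_def P_def algebra_simps)
  qed
  finally show ?thesis .
qed

text \<open>\<open>71/50\<close> is a rational upper bound for \<open>sqrt 2\<close>. Both sides
  begin with \<open>6 + 10 t\<close>; the coefficients of \<open>t^2\<close> are 3.045 and
  \<open>10/3\<close>.\<close>

lemma eventually_BCC_direction:
  "\<forall>\<^sub>F t :: real in at_right 0. 71 / 50 * t^2 + 2 * sqrt (1 + t) + 4 * sqrt (1 + t / 2) * (1 + 2 * t)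
    < 6 * (1 + t) powr (5 / 3)"
  by real_asymp

text \<open>Both sides begin with \<open>6 + 5 t\<close>; the coefficients of \<open>t^2\<close> are
  \<open>- 5/12\<close> and \<open>- 1/8\<close>.\<close>

lemma eventually_a_direction:
  "\<forall>\<^sub>F t :: real in at_right 0. 6 * (1 + t) powr (5 / 6) < 4 * sqrt (1 + t / 2) + 2 * (2 * t + 1)"
  by real_asymp

section \<open>The FCC point\<close>

lemma rho_FCC_in_domain: "rho_FCC \<in> selling_domain"
  unfolding rho_FCC_def by (rule selling_domainI) auto

lemma det_rho_FCC: "det (selling_matrix rho_FCC) = 4"
  by (simp only: rho_FCC_def det_selling_matrix)

lemma area_form_rho_FCC: "voronoi_area_form rho_FCC = 6 * sqrt 2"
  by (simp add: rho_FCC_def voronoi_area_form_def)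

lemma iso_quotient_rho_FCC: "iso_quotient rho_FCC = 12 * sqrt 2 / 4 powr (5 / 6)"
  by (simp add: iso_quotient_eq rho_FCC_in_domain det_rho_FCC area_form_rho_FCC)

text \<open>The two gradients are proportional with factor \<open>5/6 * (6 * sqrt 2) / 4\<close>,
  which is exactly the condition for the area form over the determinant to the power
  \<open>5/6\<close> to be stationary.\<close>

lemma directional_derivatives_rho_FCC:
  fixes a b c d e f :: real
  defines "k \<equiv> 4 * (a + f) + 3 * (b + c + d + e)"
  shows "((\<lambda>t. det (selling_matrix (rho_FCC + t *\<^sub>R (a, b, c, d, e, f)))) has_real_derivative k) (at 0)"
    and "((\<lambda>t. voronoi_area_form (rho_FCC + t *\<^sub>R (a, b, c, d, e, f))) has_real_derivative
      5 * sqrt 2 / 4 * k) (at 0)"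
proof -
  have sqrt2: "sqrt 2 * (sqrt 2 * x) = 2 * x" for x :: real
    by (simp flip: mult.assoc)
  show "((\<lambda>t. det (selling_matrix (rho_FCC + t *\<^sub>R (a, b, c, d, e, f)))) has_real_derivative k) (at 0)"
    unfolding rho_FCC_def scaleR_Pair add_Pair det_selling_matrix real_scaleR_def
    by (rule derivative_eq_intros refl | simp add: k_def; fail)+
  show "((\<lambda>t. voronoi_area_form (rho_FCC + t *\<^sub>R (a, b, c, d, e, f))) has_real_derivative
      5 * sqrt 2 / 4 * k) (at 0)"
    unfolding rho_FCC_def scaleR_Pair add_Pair voronoi_area_form_def prod.case real_scaleR_def
    by (rule derivative_eq_intros refl | simp; fail)+ (simp add: k_def sqrt2 field_simps)
qed

text \<open>The explicit formula has a two-sided derivative at the point; restricted to the domain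
  it agrees with the quotient, which gives the one-sided derivatives.\<close>

lemma iso_quotient_directional_derivative_rho_FCC:
  "((\<lambda>t. iso_quotient (rho_FCC + t *\<^sub>R u)) has_real_derivative 0)
    (at 0 within {t. rho_FCC + t *\<^sub>R u \<in> selling_domain})"
proof (rule has_field_derivative_transform_within[where d = 1])
  define N where "N t = voronoi_area_form (rho_FCC + t *\<^sub>R u)" for t
  define D where "D t = det (selling_matrix (rho_FCC + t *\<^sub>R u))" for t
  obtain k where D: "(D has_real_derivative k) (at 0)"
    and N: "(N has_real_derivative 5 * sqrt 2 / 4 * k) (at 0)"
    unfolding D_def N_def using directional_derivatives_rho_FCC by (cases u) blast
  have D0: "D 0 = 4" and N0: "N 0 = 6 * sqrt 2"
    by (simp_all add: D_def N_def det_rho_FCC area_form_rho_FCC)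
  have "((\<lambda>t. 2 * N t * D t powr (- (5 / 6))) has_real_derivative
      2 * (5 * sqrt 2 / 4 * k) * D 0 powr (- (5 / 6)) + 2 * N 0 * (- (5 / 6) * D 0 powr (- (5 / 6) - 1) * k)) (at 0)"
    by (rule derivative_eq_intros DERIV_fun_powr D N refl | simp add: D0)+
  moreover have "4 powr (- (5 / 6) - 1) = 4 powr (- (5 / 6)) / (4 :: real)"
    by (subst powr_diff) simp
  then have "2 * (5 * sqrt 2 / 4 * k) * D 0 powr (- (5 / 6))
      + 2 * N 0 * (- (5 / 6) * D 0 powr (- (5 / 6) - 1) * k) = 0"
    unfolding D0 N0 by (simp only:) (simp add: field_simps)
  ultimately have "((\<lambda>t. 2 * N t * D t powr (- (5 / 6))) has_real_derivative 0) (at 0)"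
    by (simp only:)
  then show "((\<lambda>t. 2 * N t * D t powr (- (5 / 6))) has_real_derivative 0)
    (at 0 within {t. rho_FCC + t *\<^sub>R u \<in> selling_domain})"
    by (rule has_field_derivative_at_within)
  show "2 * N t * D t powr (- (5 / 6)) = iso_quotient (rho_FCC + t *\<^sub>R u)"
    if "t \<in> {t. rho_FCC + t *\<^sub>R u \<in> selling_domain}" for t
    using that by (simp add: iso_quotient_eq N_def D_def powr_minus divide_simps)
qed (simp_all add: rho_FCC_in_domain)

lemma stationary_point_rho_FCC: "stationary_point iso_quotient selling_domain rho_FCC"
  by (simp add: stationary_point_def rho_FCC_in_domain iso_quotient_directional_derivative_rho_FCC)

section \<open>Descent and ascent curves through the FCC point\<close>

lemma scaled_quotient_less:
  fixes s c w M :: real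
  assumes "s > 0" "c > 0" "w > 0"
  shows "M < 6 * w \<Longrightarrow> 2 * (s * M) / (c * w) < 12 * s / c"
    and "6 * w < M \<Longrightarrow> 12 * s / c < 2 * (s * M) / (c * w)"
  using assms by (simp_all add: field_simps)

lemma not_local_minimiser_rho_FCC: "\<not> local_minimiser iso_quotient selling_domain rho_FCC"
proof
  assume min: "local_minimiser iso_quotient selling_domain rho_FCC"
  define \<gamma> :: "real \<Rightarrow> selling" where "\<gamma> t = (t, 1, 1, 1, 1, t)" for t
  have dom: "\<gamma> t \<in> selling_domain" if "t > 0" for t
    unfolding \<gamma>_def using that by (intro selling_domainI) auto
  have "(\<gamma> \<longlongrightarrow> rho_FCC) (at_right 0)"
    unfolding \<gamma>_def rho_FCC_def by (intro tendsto_intros)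
  moreover have "\<forall>\<^sub>F t in at_right 0. \<gamma> t \<in> selling_domain - {rho_FCC}"
    using eventually_at_right_less[of "0::real"]
    by eventually_elim (use dom in \<open>auto simp: \<gamma>_def rho_FCC_def\<close>)
  ultimately have "filterlim \<gamma> (at rho_FCC within selling_domain) (at_right 0)"
    unfolding filterlim_at by (auto elim: eventually_mono)
  then have "\<forall>\<^sub>F t in at_right 0. iso_quotient rho_FCC \<le> iso_quotient (\<gamma> t)"
    using min unfolding local_minimiser_def filterlim_iff by blast
  moreover note eventually_BCC_direction eventually_at_right_less[of "0::real"]
  ultimately have "\<forall>\<^sub>F t :: real in at_right 0. False"
  proof eventually_elim
    case (elim t)
    let ?M = "sqrt 2 * t\<^sup>2 + 2 * sqrt (1 + t) + 4 * sqrt (1 + t / 2) * (1 + 2 * t)"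
    have "voronoi_area_form (\<gamma> t) = 2 * t\<^sup>2 + 2 * sqrt (2 * (1 + t)) + 4 * sqrt (2 * (1 + t / 2)) * (1 + 2 * t)"
      by (simp add: voronoi_area_form_def \<gamma>_def power2_eq_square add_ac algebra_simps)
    also have "\<dots> = sqrt 2 * ?M"
      by (simp only: real_sqrt_mult) (simp add: algebra_simps)
    finally have N: "voronoi_area_form (\<gamma> t) = sqrt 2 * ?M" .
    have D: "det (selling_matrix (\<gamma> t)) = 4 * (1 + t)\<^sup>2"
      unfolding \<gamma>_def det_selling_matrix by (simp add: power2_eq_square algebra_simps)
    have "sqrt 2 \<le> 71 / 50"
      by (rule real_le_lsqrt) (simp_all add: power2_eq_square)
    then have "sqrt 2 * t\<^sup>2 \<le> 71 / 50 * t\<^sup>2"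
      by (intro mult_right_mono) auto
    then have "?M < 6 * (1 + t) powr (5 / 3)"
      using elim by linarith
    moreover have P: "(4 * (1 + t)\<^sup>2) powr (5 / 6) = 4 powr (5 / 6) * (1 + t) powr (5 / 3)"
      using elim by (simp add: powr_mult powr_powr flip: powr_numeral)
    moreover have "(1 + t) powr (5 / 3) > 0"
      using elim by simp
    ultimately have "2 * (sqrt 2 * ?M) / (4 powr (5 / 6) * (1 + t) powr (5 / 3)) < 12 * sqrt 2 / 4 powr (5 / 6)"
      by (intro scaled_quotient_less(1)) simp_all
    then have "iso_quotient (\<gamma> t) < iso_quotient rho_FCC"
      by (simp only: iso_quotient_eq[OF dom[OF \<open>0 < t\<close>]] N D P iso_quotient_rho_FCC)
    with elim show False
      by simp
  qed
  then show False
    by simp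
qed

lemma not_local_maximiser_rho_FCC: "\<not> local_maximiser iso_quotient selling_domain rho_FCC"
proof
  assume max: "local_maximiser iso_quotient selling_domain rho_FCC"
  define \<gamma> :: "real \<Rightarrow> selling" where "\<gamma> t = (t, 1, 1, 1, 1, 0)" for t
  have dom: "\<gamma> t \<in> selling_domain" if "t > 0" for t
    unfolding \<gamma>_def using that by (intro selling_domainI) auto
  have "(\<gamma> \<longlongrightarrow> rho_FCC) (at_right 0)"
    unfolding \<gamma>_def rho_FCC_def by (intro tendsto_intros)
  moreover have "\<forall>\<^sub>F t in at_right 0. \<gamma> t \<in> selling_domain - {rho_FCC}"
    using eventually_at_right_less[of "0::real"]
    by eventually_elim (use dom in \<open>auto simp: \<gamma>_def rho_FCC_def\<close>)
  ultimately have "filterlim \<gamma> (at rho_FCC within selling_domain) (at_right 0)"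
    unfolding filterlim_at by (auto elim: eventually_mono)
  then have "\<forall>\<^sub>F t in at_right 0. iso_quotient (\<gamma> t) \<le> iso_quotient rho_FCC"
    using max unfolding local_maximiser_def filterlim_iff by blast
  moreover note eventually_a_direction eventually_at_right_less[of "0::real"]
  ultimately have "\<forall>\<^sub>F t :: real in at_right 0. False"
  proof eventually_elim
    case (elim t)
    let ?M = "4 * sqrt (1 + t / 2) + 2 * (2 * t + 1)"
    have "voronoi_area_form (\<gamma> t) = 4 * sqrt (2 * (1 + t / 2)) + 2 * sqrt 2 * (2 * t + 1)"
      by (simp add: voronoi_area_form_def \<gamma>_def add_ac algebra_simps)
    also have "\<dots> = sqrt 2 * ?M"
      by (simp only: real_sqrt_mult) (simp add: algebra_simps)
    finally have N: "voronoi_area_form (\<gamma> t) = sqrt 2 * ?M" .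
    have D: "det (selling_matrix (\<gamma> t)) = 4 * (1 + t)"
      unfolding \<gamma>_def det_selling_matrix by simp
    have P: "(4 * (1 + t)) powr (5 / 6) = 4 powr (5 / 6) * (1 + t) powr (5 / 6)"
      by (rule powr_mult)
    have "(1 + t) powr (5 / 6) > 0"
      using elim by simp
    then have "12 * sqrt 2 / 4 powr (5 / 6) < 2 * (sqrt 2 * ?M) / (4 powr (5 / 6) * (1 + t) powr (5 / 6))"
      using elim by (intro scaled_quotient_less(2)) simp_all
    then have "iso_quotient rho_FCC < iso_quotient (\<gamma> t)"
      by (simp only: iso_quotient_eq[OF dom[OF \<open>0 < t\<close>]] N D P iso_quotient_rho_FCC)
    with elim show False
      by simp
  qed
  then show False
    by simp
qed

text \<open>At equal determinants the quotients compare like the area forms, so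
  \<open>area_form_RD_gt\<close> decides.\<close>

lemma strict_local_minimiser_rho_FCC:
  "strict_local_minimiser iso_quotient
    {\<rho> \<in> Sigma_RD. det (selling_matrix \<rho>) = det (selling_matrix rho_FCC)} rho_FCC"
    (is "strict_local_minimiser _ ?D _")
  unfolding strict_local_minimiser_def
proof
  show "rho_FCC \<in> ?D"
    by (simp add: Sigma_RD_def selling_orthant_def rho_FCC_def)
  let ?I = "{999 / 1000 <..< 1001 / 1000 :: real}"
  \<comment> \<open>The first and last coordinates are free because they vanish on the stratum; the
    four intervals match the radius in \<open>area_form_RD_gt\<close>.\<close>
  let ?U = "UNIV \<times> ?I \<times> ?I \<times> ?I \<times> ?I \<times> UNIV :: selling set"
  show "\<forall>\<^sub>F \<rho> in at rho_FCC within ?D. iso_quotient rho_FCC < iso_quotient \<rho>"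
    unfolding eventually_at_topological
  proof (intro exI[of _ ?U] conjI ballI impI)
    show "open ?U"
      by (intro open_Times open_UNIV open_greaterThanLessThan)
    show "rho_FCC \<in> ?U"
      by (simp add: rho_FCC_def)
  next
    fix \<rho> assume U: "\<rho> \<in> ?U" and ne: "\<rho> \<noteq> rho_FCC" and D: "\<rho> \<in> ?D"
    obtain b c d e where \<rho>: "\<rho> = (0, b, c, d, e, 0)" and pos: "b > 0" "c > 0" "d > 0" "e > 0"
      using U D by (cases \<rho>) (auto simp: Sigma_RD_def)
    have det: "det (selling_matrix \<rho>) = 4"
      using D det_rho_FCC by simp
    then have det': "b * c * d + b * c * e + b * d * e + c * d * e = 4"
      unfolding \<rho> det_selling_matrix by simp
    have ne': "\<not> (b = 1 \<and> c = 1 \<and> d = 1 \<and> e = 1)"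
      using ne by (auto simp: \<rho> rho_FCC_def)
    have near: "\<bar>v - 1\<bar> \<le> 1 / 1000" if "v \<in> ?I" for v :: real
      using that by (simp only: greaterThanLessThan_iff) linarith
    have "b \<in> ?I" "c \<in> ?I" "d \<in> ?I" "e \<in> ?I"
      using U by (simp_all only: \<rho> mem_Times_iff fst_conv snd_conv)
    from area_form_RD_gt[OF this[THEN near] det' ne']
    have "6 * sqrt 2 < b * e * sqrt (c + d) + c * d * sqrt (b + e) + d * e * sqrt (b + c)
      + b * c * sqrt (d + e) + c * e * sqrt (b + d) + b * d * sqrt (c + e)" .
    then have "6 * sqrt 2 < voronoi_area_form \<rho>"
      by (simp add: \<rho> voronoi_area_form_def algebra_simps)
    moreover have "\<rho> \<in> selling_domain"
      unfolding \<rho> using pos by (intro selling_domainI) auto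
    ultimately show "iso_quotient rho_FCC < iso_quotient \<rho>"
      by (simp add: iso_quotient_rho_FCC iso_quotient_eq det divide_strict_right_mono)
  qed
qed

theorem theorem3p3:
  shows "stationary_point iso_quotient selling_domain rho_FCC
    \<and> \<not> local_minimiser iso_quotient selling_domain rho_FCC
    \<and> saddle_point iso_quotient selling_domain rho_FCC
    \<and> strict_local_minimiser iso_quotient
        {\<rho> \<in> Sigma_RD. det (selling_matrix \<rho>) = det (selling_matrix rho_FCC)} rho_FCC"
  using stationary_point_rho_FCC not_local_minimiser_rho_FCC not_local_maximiser_rho_FCC
    strict_local_minimiser_rho_FCC
  by (simp add: saddle_point_def)

end
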